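(* Let the basis functions be the scaled monomials, the Bessel functions of the first kind, or the modified Bessel functions of the first kind, and let $F_N$, $Q_{1,N}$, $\beta$, $r_N$, $u_N(t)$ and $u_N^{IA}(t)$ be as defined in the context. Suppose there exists a constant $c>0$ such that $\|g^{(\ell)}(0)\|\le c\,\|A\|^\ell$ for all $\ell\ge0$. Suppose the infinite Arnoldi algorithm generates Hessenberg matrices $F_N$ such that, for some constant $C$, $$\|F_N^N\|\le C^N\quad\text{for all }N>0 .$$ Then $b_N:=-Q_{1,N}\,r_N(tF_N)e_1\beta$ satisfies $$\|b_N\|\to0\quad\text{as }N\to\infty .$$ Moreover, the Arnoldi error satisfies $$\|u_N(t)-u_N^{IA}(t)\|\to0\quad\text{as }N\to\infty$$ (for each fixed $t\ge0$).
   Context: $\|\cdot\|$ is the Euclidean vector norm or spectral matrix norm, and $e_1$ is the first unit vector of consistent size. $A\in\mathbb{C}^{n\times n}$, $u_0\in\mathbb{C}^n$, and $g:\mathbb{C}\to\mathbb{C}^n$ has entire components and is expanded as $g(s)=\sum_{\ell=0}^\infty w_\ell\phi_\ell(s)$ with $w_\ell\in\mathbb{C}^n$. $W_N=[w_0\ \cdots\ w_{N-1}]\in\mathbb{C}^{n\times N}$ and $$A_N=\begin{bmatrix}A&W_N\\0&H_N\end{bmatrix}\in\mathbb{C}^{(n+N)\times(n+N)},\qquad u_N(t)=\begin{bmatrix}I_n&0\end{bmatrix}\exp(tA_N)\begin{bmatrix}u_0\\ e_1\end{bmatrix}.$$ The basis functions $\phi_\ell$ and matrices $H_N\in\mathbb{R}^{N\times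 N}$ are one of: (i) scaled monomials $\phi_\ell(t)=t^\ell/\ell!$, with $H_N$ having ones on the first subdiagonal and zeros elsewhere; (ii) Bessel functions $\phi_\ell(t)=J_\ell(t)=\frac1\pi\int_0^\pi\cos(\ell\tau-t\sin\tau)\,d\tau$, with $H_N$ tridiagonal with zero diagonal, subdiagonal entries $\tfrac12$, $(H_N)_{1,2}=-1$ and remaining superdiagonal entries $-\tfrac12$; (iii) modified Bessel functions $\phi_\ell(t)=I_\ell(t)=(-\mathrm i)^\ell J_\ell(\mathrm it)$, with $H_N$ tridiagonal with zero diagonal, subdiagonal entries $\tfrac12$, $(H_N)_{1,2}=1$ and remaining superdiagonal entries $\tfrac12$. In all these cases $g^{(\ell)}(0)=W_NH_N^\ell e_1$ for $\ell<N$. Arnoldi data: $\beta=\left\|\begin{bmatrix}u_0\\ e_1\end{bmatrix}\right\|$. $N$ steps of the infinite Arnoldi algorithm are equivalent to $N$ steps of the Arnoldi process for $A_N$ with starting vector $b=\begin{bmatrix}u_0\\ e_1\end{bmatrix}\in\mathbb{C}^{n+N}$: $q_1=b/\beta$ and, for $k=1,2,\dots,N-1$, $q_{k+1}$ is obtained by orthogonalizing $A_Nq_k$ against $q_1,\dots,q_k$ (Gram–Schmidt) and normalizing to unit norm with positive scaling. This gives $Q_N=[q_1,\dots,q_N]\in\mathbb{C}^{(n+N)\times N}$ with orthonormal columns spanning $\mathrm{span}(b,A_Nb,\dots,A_N^{N-1}b)$ and the Hessenberg matrix $F_N=Q_N^*A_NQ_N$. $Q_{1,N}\in\mathbb{C}^{n\times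 N}$ denotes the first $n$ rows of $Q_N$. The infinite Arnoldi approximation is $u_N^{IA}(t)=Q_{1,N}\exp(tF_N)e_1\beta$. Finally $r_N(z)=\sum_{\ell=N}^\infty z^\ell/\ell!$. *)

theory Defs
  imports "HOL-Analysis.Analysis" "Jordan_Normal_Form.Schur_Decomposition"
begin

text \<open>Vectors and matrices whose sizes vary with \<open>N\<close> are those of \<open>Jordan_Normal_Form\<close>.
  All indices are shifted to start at \<open>0\<close>, so the first unit vector of length \<open>N\<close> is
  \<open>unit_vec N 0\<close>.\<close>

unbundle no vec_syntax
unbundle no inner_syntax
hide_const (open) Finite_Cartesian_Product.vec Finite_Cartesian_Product.mat

definition l2_norm :: "complex vec \<Rightarrow> real" where
  "l2_norm v = L2_set (\<lambda>i. cmod (v $ i)) {..<dim_vec v}"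

definition spectral_norm :: "complex mat \<Rightarrow> real" where
  "spectral_norm M =
     (SUP v \<in> {v \<in> carrier_vec (dim_col M). l2_norm v \<le> 1}. l2_norm (M *\<^sub>v v))"

definition mat_power_series :: "(nat \<Rightarrow> complex) \<Rightarrow> complex mat \<Rightarrow> complex mat" where
  "mat_power_series a M =
     mat (dim_row M) (dim_row M) (\<lambda>(i, j). \<Sum>k. a k * (M ^\<^sub>m k) $$ (i, j))"

definition mat_exp :: "complex mat \<Rightarrow> complex mat" where
  "mat_exp = mat_power_series (\<lambda>k. 1 / fact k)"

definition mat_exp_tail :: "nat \<Rightarrow> complex mat \<Rightarrow> complex mat" where
  "mat_exp_tail N = mat_power_series (\<lambda>k. if k < N then 0 else 1 / fact k)"

definition bessel_J :: "nat \<Rightarrow> complex \<Rightarrow> complex" where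
  "bessel_J l z = (1 / of_real pi) *
     integral {0..pi} (\<lambda>\<tau>. cos (of_nat l * of_real \<tau> - z * of_real (sin \<tau>)))"

definition bessel_I :: "nat \<Rightarrow> complex \<Rightarrow> complex" where
  "bessel_I l z = (- \<i>) ^ l * bessel_J l (\<i> * z)"

datatype basis_kind = Monomials | Bessel | Modified_Bessel

fun basis_fun :: "basis_kind \<Rightarrow> nat \<Rightarrow> complex \<Rightarrow> complex" where
  "basis_fun Monomials l z = z ^ l / fact l"
| "basis_fun Bessel l z = bessel_J l z"
| "basis_fun Modified_Bessel l z = bessel_I l z"

text \<open>The infinite version \<open>H\<close> of \<open>basis_mat kind N\<close> satisfies \<open>\<phi>' = H \<phi>\<close> for the column of basis
  functions \<open>\<phi>\<close>; row \<open>0\<close> is special because \<open>J\<^sub>0' = - J\<^sub>1\<close> and \<open>I\<^sub>0' = I\<^sub>1\<close>.\<close>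

fun basis_mat :: "basis_kind \<Rightarrow> nat \<Rightarrow> real mat" where
  "basis_mat Monomials N = mat N N (\<lambda>(i, j). if i = Suc j then 1 else 0)"
| "basis_mat Bessel N = mat N N (\<lambda>(i, j).
     if i = Suc j then 1 / 2
     else if j = Suc i then (if i = 0 then - 1 else - (1 / 2))
     else 0)"
| "basis_mat Modified_Bessel N = mat N N (\<lambda>(i, j).
     if i = Suc j then 1 / 2
     else if j = Suc i then (if i = 0 then 1 else 1 / 2)
     else 0)"

definition coeff_mat :: "nat \<Rightarrow> (nat \<Rightarrow> complex vec) \<Rightarrow> nat \<Rightarrow> complex mat" where
  "coeff_mat n w N = mat_of_cols n (map w [0..<N])"

definition augmented_mat ::
  "basis_kind \<Rightarrow> complex mat \<Rightarrow> (nat \<Rightarrow> complex vec) \<Rightarrow> nat \<Rightarrow> complex mat" where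
  "augmented_mat kind A w N =
     four_block_mat A (coeff_mat (dim_row A) w N)
       (0\<^sub>m N (dim_row A)) (map_mat complex_of_real (basis_mat kind N))"

definition start_vec :: "complex vec \<Rightarrow> nat \<Rightarrow> complex vec" where
  "start_vec u0 N = u0 @\<^sub>v unit_vec N 0"

text \<open>The block row with blocks \<open>1\<^sub>m n\<close> and \<open>0\<^sub>m n N\<close>.\<close>

definition top_selector :: "nat \<Rightarrow> nat \<Rightarrow> complex mat" where
  "top_selector n N = four_block_mat (1\<^sub>m n) (0\<^sub>m n N) (0\<^sub>m 0 n) (0\<^sub>m 0 N)"

definition truncated_sol ::
  "basis_kind \<Rightarrow> complex mat \<Rightarrow> complex vec \<Rightarrow> (nat \<Rightarrow> complex vec) \<Rightarrow> nat \<Rightarrow> real \<Rightarrow> complex vec" where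
  "truncated_sol kind A u0 w N t =
     top_selector (dim_row A) N *\<^sub>v
       (mat_exp (complex_of_real t \<cdot>\<^sub>m augmented_mat kind A w N) *\<^sub>v start_vec u0 N)"

definition normalize_vec :: "complex vec \<Rightarrow> complex vec" where
  "normalize_vec v = complex_of_real (1 / l2_norm v) \<cdot>\<^sub>v v"

definition orthogonalize :: "complex vec list \<Rightarrow> complex vec \<Rightarrow> complex vec" where
  "orthogonalize qs v = vec (dim_vec v) (\<lambda>i. v $ i - (\<Sum>q\<leftarrow>qs. (v \<bullet>c q) * q $ i))"

text \<open>\<open>arnoldi M b N\<close> is the list of the first \<open>N\<close> Arnoldi vectors. A breakdown would produce a
  zero vector; for \<open>M = augmented_mat kind A w N\<close> and \<open>b = start_vec u0 N\<close> it does not happen within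
  \<open>N\<close> steps, since the lower block of \<open>M\<close> is Hessenberg with nonzero subdiagonal.\<close>

fun arnoldi :: "complex mat \<Rightarrow> complex vec \<Rightarrow> nat \<Rightarrow> complex vec list" where
  "arnoldi M b 0 = []"
| "arnoldi M b (Suc 0) = [normalize_vec b]"
| "arnoldi M b (Suc (Suc k)) =
     (let qs = arnoldi M b (Suc k)
      in qs @ [normalize_vec (orthogonalize qs (M *\<^sub>v last qs))])"

text \<open>\<open>N\<close> steps of the infinite Arnoldi algorithm are represented by the equivalent \<open>N\<close> steps of the
  Arnoldi process for the augmented matrix of size \<open>n + N\<close>.\<close>

definition arnoldi_Q ::
  "basis_kind \<Rightarrow> complex mat \<Rightarrow> complex vec \<Rightarrow> (nat \<Rightarrow> complex vec) \<Rightarrow> nat \<Rightarrow> complex mat" where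
  "arnoldi_Q kind A u0 w N =
     mat_of_cols (dim_row A + N) (arnoldi (augmented_mat kind A w N) (start_vec u0 N) N)"

definition arnoldi_F ::
  "basis_kind \<Rightarrow> complex mat \<Rightarrow> complex vec \<Rightarrow> (nat \<Rightarrow> complex vec) \<Rightarrow> nat \<Rightarrow> complex mat" where
  "arnoldi_F kind A u0 w N =
     mat_adjoint (arnoldi_Q kind A u0 w N) * augmented_mat kind A w N * arnoldi_Q kind A u0 w N"

definition arnoldi_Q1 ::
  "basis_kind \<Rightarrow> complex mat \<Rightarrow> complex vec \<Rightarrow> (nat \<Rightarrow> complex vec) \<Rightarrow> nat \<Rightarrow> complex mat" where
  "arnoldi_Q1 kind A u0 w N = mat (dim_row A) N (\<lambda>(i, j). arnoldi_Q kind A u0 w N $$ (i, j))"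

definition arnoldi_beta :: "complex vec \<Rightarrow> nat \<Rightarrow> complex" where
  "arnoldi_beta u0 N = complex_of_real (l2_norm (start_vec u0 N))"

definition arnoldi_sol ::
  "basis_kind \<Rightarrow> complex mat \<Rightarrow> complex vec \<Rightarrow> (nat \<Rightarrow> complex vec) \<Rightarrow> nat \<Rightarrow> real \<Rightarrow> complex vec" where
  "arnoldi_sol kind A u0 w N t =
     arnoldi_beta u0 N \<cdot>\<^sub>v
       (arnoldi_Q1 kind A u0 w N *\<^sub>v
         (mat_exp (complex_of_real t \<cdot>\<^sub>m arnoldi_F kind A u0 w N) *\<^sub>v unit_vec N 0))"

definition arnoldi_tail ::
  "basis_kind \<Rightarrow> complex mat \<Rightarrow> complex vec \<Rightarrow> (nat \<Rightarrow> complex vec) \<Rightarrow> nat \<Rightarrow> real \<Rightarrow> complex vec" where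
  "arnoldi_tail kind A u0 w N t =
     - (arnoldi_beta u0 N \<cdot>\<^sub>v
         (arnoldi_Q1 kind A u0 w N *\<^sub>v
           (mat_exp_tail N (complex_of_real t \<cdot>\<^sub>m arnoldi_F kind A u0 w N) *\<^sub>v unit_vec N 0)))"

definition deriv_vec_at_0 :: "nat \<Rightarrow> (complex \<Rightarrow> complex vec) \<Rightarrow> nat \<Rightarrow> complex vec" where
  "deriv_vec_at_0 n g l = vec n (\<lambda>i. (deriv ^^ l) (\<lambda>s. g s $ i) 0)"

end

theory Submission
  imports Defs
begin

text \<open>For every polynomial \<open>p\<close> of degree below \<open>N\<close> the Arnoldi process gives
  \<open>Q\<^sub>N p(F\<^sub>N) \<beta> e\<^sub>1 = p(A\<^sub>N) b\<close> (\<open>arnoldi_krylov\<close>). The first \<open>N\<close> terms of the two exponential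
  series therefore cancel in the Arnoldi error, and both claims reduce to tails of index \<open>k \<ge> N\<close>. They
  follow once the vectors \<open>Q\<^sub>1\<^sub>,\<^sub>N F\<^sub>N\<^sup>k \<beta> e\<^sub>1\<close> and the top blocks of \<open>A\<^sub>N\<^sup>k b\<close> are bounded, for \<open>k \<ge> N\<close>, by
  \<open>D K\<^sup>k\<close> with \<open>D\<close> and \<open>K\<close> independent of \<open>N\<close>: such tails are dominated by tails of the
  series for \<open>D exp(t K)\<close>.

  The norms of \<open>A\<^sub>N\<close> and \<open>F\<^sub>N\<close> are of no help for this. The coefficients \<open>w\<^sub>l\<close> may grow
  geometrically, so that \<open>\<parallel>F\<^sub>N\<parallel>\<^sup>r\<close> with \<open>r\<close> close to \<open>N\<close> may be as large as \<open>a\<close> to the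
  power \<open>N\<^sup>2\<close>. The bounds come from eigenvalues instead. Fix a component of a
  Krylov sequence \<open>L M\<^sup>k u\<close> with \<open>M\<close> of size \<open>m\<close>. By the theorem of Cayley and Hamilton it obeys a linear
  recurrence whose characteristic roots are the eigenvalues of \<open>M\<close>; if these are bounded by \<open>C\<close> and the first
  \<open>m\<close> terms by \<open>B\<close>, then the \<open>k\<close>-th term is bounded by \<open>B (1 + C)\<^sup>m\<^sup>+\<^sup>k\<close> (\<open>krylov_bound\<close>). For \<open>k \<ge> m\<close>
  this is geometric in \<open>k\<close>, with a ratio that does not see \<open>m\<close>.

  This is applied twice. The eigenvalues of \<open>F\<^sub>N\<close> are at most \<open>C\<close> because \<open>\<parallel>F\<^sub>N\<^sup>N\<parallel> \<le> C\<^sup>N\<close>, and the first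
  \<open>N\<close> terms of \<open>Q\<^sub>1\<^sub>,\<^sub>N F\<^sub>N\<^sup>k \<beta> e\<^sub>1\<close> are top blocks of \<open>A\<^sub>N\<^sup>k b\<close>. Those blocks are assembled from powers of
  \<open>A\<close>, from \<open>u\<^sub>0\<close>, and from the vectors \<open>W\<^sub>N H\<^sub>N\<^sup>j e\<^sub>1\<close>. The latter equal \<open>g\<^sup>(\<^sup>j\<^sup>)(0)\<close> for \<open>j < N\<close>, where the
  growth hypothesis on \<open>g\<close> applies; for \<open>j \<ge> N\<close> the eigenvalue argument is used with \<open>H\<^sub>N\<close>, whose
  eigenvalues are at most \<open>1\<close> since its absolute row sums are (\<open>top_krylov_bound\<close>).

  The identity \<open>W\<^sub>N H\<^sub>N\<^sup>j e\<^sub>1 = g\<^sup>(\<^sup>j\<^sup>)(0)\<close> needs a rearrangement of the expansion of \<open>g\<close>, of which only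
  pointwise convergence is known. It is made absolute by a majorant of each basis function that is attained, in
  modulus, along one ray from the origin (\<open>higher_deriv_basis_expansion\<close>).\<close>

section \<open>Taylor coefficients of the basis functions\<close>

fun sub_coeff :: "basis_kind \<Rightarrow> real" where
  "sub_coeff Monomials = 1"
| "sub_coeff Bessel = 1 / 2"
| "sub_coeff Modified_Bessel = 1 / 2"

fun super_coeff :: "basis_kind \<Rightarrow> nat \<Rightarrow> real" where
  "super_coeff Monomials i = 0"
| "super_coeff Bessel i = (if i = 0 then - 1 else - (1 / 2))"
| "super_coeff Modified_Bessel i = (if i = 0 then 1 else 1 / 2)"

text \<open>The number \<open>taylor kind k l\<close> is both entry \<open>l\<close> of \<open>H\<^sup>k e\<^sub>1\<close>, for the infinite matrix \<open>H\<close>, and the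
  \<open>k\<close>-th derivative of \<open>\<phi>\<^sub>l\<close> at \<open>0\<close>. The recursion is the former; \<open>basis_fun_sums\<close> is the latter.\<close>

fun taylor :: "basis_kind \<Rightarrow> nat \<Rightarrow> nat \<Rightarrow> real" where
  "taylor kind 0 l = (if l = 0 then 1 else 0)"
| "taylor kind (Suc k) l =
     (if l = 0 then 0 else sub_coeff kind * taylor kind k (l - 1))
     + super_coeff kind l * taylor kind k (Suc l)"

lemma taylor_upper_zero: "k < l \<Longrightarrow> taylor kind k l = 0"
  by (induction k arbitrary: l) auto

lemma coeff_row_sum: "(if l = 0 then 0 else \<bar>sub_coeff kind\<bar>) + \<bar>super_coeff kind l\<bar> \<le> 1"
  by (cases kind) auto

lemma abs_taylor_le_1: "\<bar>taylor kind k l\<bar> \<le> 1"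
proof (induction k arbitrary: l)
  case (Suc k)
  have "\<bar>taylor kind (Suc k) l\<bar> \<le>
      (if l = 0 then 0 else \<bar>sub_coeff kind\<bar> * \<bar>taylor kind k (l - 1)\<bar>)
      + \<bar>super_coeff kind l\<bar> * \<bar>taylor kind k (Suc l)\<bar>"
    using abs_triangle_ineq[of "sub_coeff kind * taylor kind k (l - 1)" "super_coeff kind l * taylor kind k (Suc l)"]
    by (simp flip: abs_mult)
  also have "\<dots> \<le> (if l = 0 then 0 else \<bar>sub_coeff kind\<bar> * 1) + \<bar>super_coeff kind l\<bar> * 1"
    using Suc by (intro add_mono) (auto intro!: mult_right_le_one_le)
  also have "\<dots> \<le> 1" using coeff_row_sum[of l kind] by (cases l) simp_all
  finally show ?case .
qed simp

lemma taylor_Monomials: "taylor Monomials k l = (if k = l then 1 else 0)"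
  by (induction k arbitrary: l) auto

lemma taylor_Modified_Bessel_nonneg: "0 \<le> taylor Modified_Bessel k l"
  by (induction k arbitrary: l) auto

text \<open>The coefficient form of \<open>J\<^sub>l(\<i> x) = \<i>\<^sup>l I\<^sub>l(x)\<close>: along the imaginary axis all Taylor terms of \<open>J\<^sub>l\<close>
  have the same argument.\<close>

lemma taylor_Bessel_Modified:
  "\<i> ^ k * complex_of_real (taylor Bessel k l) = \<i> ^ l * complex_of_real (taylor Modified_Bessel k l)"
proof (induction k arbitrary: l)
  case (Suc k)
  have "\<i> ^ Suc k * complex_of_real (taylor Bessel (Suc k) l) =
      \<i> * ((if l = 0 then 0 else (1/2) * (\<i> ^ k * complex_of_real (taylor Bessel k (l - 1))))
       + complex_of_real (super_coeff Bessel l) * (\<i> ^ k * complex_of_real (taylor Bessel k (Suc l))))"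
    by (simp add: algebra_simps)
  also have "\<dots> = \<i> ^ l * complex_of_real (taylor Modified_Bessel (Suc k) l)"
    unfolding Suc by (cases l) (simp_all add: algebra_simps)
  finally show ?case .
qed simp

lemma abs_taylor_Bessel: "\<bar>taylor Bessel k l\<bar> = taylor Modified_Bessel k l"
  using arg_cong[OF taylor_Bessel_Modified[of k l], of cmod] taylor_Modified_Bessel_nonneg[of k l]
  by (simp add: norm_mult norm_power)

lemma cos_diff_sums:
  fixes y :: complex
  shows "(\<lambda>k. complex_of_real (cos (\<theta> - real k * pi / 2)) * y ^ k / fact k) sums cos (of_real \<theta> - y)"
proof -
  \<comment> \<open>The Taylor coefficients of cosine and sine in a form to which the addition theorem applies.\<close>
  have co: "cos_coeff k = cos (real k * pi / 2) / fact k \<and> sin_coeff k = sin (real k * pi / 2) / fact k" for k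
  proof (induction k)
    case (Suc k)
    have "real (Suc k) * pi / 2 = real k * pi / 2 + pi / 2" by (simp add: field_simps)
    then have "cos (real (Suc k) * pi / 2) = - sin (real k * pi / 2)"
      "sin (real (Suc k) * pi / 2) = cos (real k * pi / 2)"
      by (simp_all only: cos_add sin_add) simp_all
    then show ?case using Suc by (simp add: cos_coeff_Suc sin_coeff_Suc field_simps del: of_nat_Suc)
  qed simp
  have "(\<lambda>k. of_real (cos \<theta>) * (cos_coeff k *\<^sub>R y ^ k) + of_real (sin \<theta>) * (sin_coeff k *\<^sub>R y ^ k))
      sums (of_real (cos \<theta>) * cos y + of_real (sin \<theta>) * sin y)"
    by (intro sums_add sums_mult cos_converges sin_converges)
  also have "of_real (cos \<theta>) * cos y + of_real (sin \<theta>) * sin y = cos (of_real \<theta> - y)"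
    by (simp add: cos_diff cos_of_real sin_of_real)
  also have "(\<lambda>k. of_real (cos \<theta>) * (cos_coeff k *\<^sub>R y ^ k) + of_real (sin \<theta>) * (sin_coeff k *\<^sub>R y ^ k))
     = (\<lambda>k. complex_of_real (cos (\<theta> - real k * pi / 2)) * y ^ k / fact k)"
    using co by (simp add: fun_eq_iff scaleR_conv_of_real cos_diff add_divide_distrib algebra_simps)
  finally show ?thesis .
qed

text \<open>The trigonometric form of \<open>2 J\<^sub>l' = J\<^sub>l\<^sub>-\<^sub>1 - J\<^sub>l\<^sub>+\<^sub>1\<close> and \<open>J\<^sub>0' = - J\<^sub>1\<close> at the origin: the integrand is the
  \<open>k\<close>-th derivative of \<open>z \<mapsto> cos(l \<tau> - z sin \<tau>)\<close> at \<open>0\<close>, and the product formula for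
  \<open>sin \<tau>\<close> times a cosine shifts \<open>l\<close> by one in both directions. For \<open>l = 0\<close> the two neighbours are merged
  with the help of \<open>\<integral> cos \<tau> sin\<^sup>k \<tau> = 0\<close>.\<close>

lemma has_integral_taylor_Bessel:
  "((\<lambda>\<tau>. cos (real l * \<tau> - real k * pi / 2) * sin \<tau> ^ k) has_integral pi * taylor Bessel k l) {0..pi}"
proof (induction k arbitrary: l)
  case 0
  show ?case
  proof (cases "l = 0")
    case True
    then show ?thesis using has_integral_const_real[of "1::real" 0 pi] by simp
  next
    case False
    have "((\<lambda>\<tau>. cos (real l * \<tau>)) has_integral (sin (real l * pi) / l - sin (real l * 0) / l)) {0..pi}"
      using False
      by (intro fundamental_theorem_of_calculus)
        (auto intro!: derivative_eq_intros simp flip: has_real_derivative_iff_has_vector_derivative)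
    then show ?thesis using False by simp
  qed
next
  case (Suc k)
  show ?case
  proof (cases "l = 0")
    case False
    then obtain l' where l: "l = Suc l'" by (cases l) auto
    have "((\<lambda>\<tau>. (1/2) * (cos (real l' * \<tau> - real k * pi / 2) * sin \<tau> ^ k
        - cos (real (Suc l) * \<tau> - real k * pi / 2) * sin \<tau> ^ k))
        has_integral (1/2) * (pi * taylor Bessel k l' - pi * taylor Bessel k (Suc l))) {0..pi}"
      by (intro has_integral_mult_right has_integral_diff Suc)
    also have "(\<lambda>\<tau>. (1/2) * (cos (real l' * \<tau> - real k * pi / 2) * sin \<tau> ^ k
        - cos (real (Suc l) * \<tau> - real k * pi / 2) * sin \<tau> ^ k)) =
        (\<lambda>\<tau>. cos (real l * \<tau> - real (Suc k) * pi / 2) * sin \<tau> ^ Suc k)"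
    proof
      fix \<tau> :: real
      define \<alpha> where "\<alpha> = real l * \<tau> - real k * pi / 2"
      have *: "real l' * \<tau> - real k * pi / 2 = \<alpha> - \<tau>" "real (Suc l) * \<tau> - real k * pi / 2 = \<alpha> + \<tau>"
        "real l * \<tau> - real (Suc k) * pi / 2 = \<alpha> - pi / 2"
        by (simp_all add: \<alpha>_def l field_simps)
      show "(1/2) * (cos (real l' * \<tau> - real k * pi / 2) * sin \<tau> ^ k
        - cos (real (Suc l) * \<tau> - real k * pi / 2) * sin \<tau> ^ k) =
        cos (real l * \<tau> - real (Suc k) * pi / 2) * sin \<tau> ^ Suc k"
        unfolding * by (simp add: cos_add cos_diff algebra_simps)
    qed
    finally show ?thesis using l by (simp add: algebra_simps)
  next
    case True
    have "(cos \<tau> * sin \<tau> ^ k + real k * (cos \<tau> * sin \<tau> ^ (k - 1)) * sin \<tau>) / real (Suc k)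
        = cos \<tau> * sin \<tau> ^ k" for \<tau> :: real
      by (cases k) (auto simp: field_simps)
    then have 1: "((\<lambda>\<tau>. cos \<tau> * sin \<tau> ^ k) has_integral
        (sin pi ^ Suc k / real (Suc k) - sin 0 ^ Suc k / real (Suc k))) {0..pi}"
      by (intro fundamental_theorem_of_calculus)
        (auto intro!: derivative_eq_intros
          simp flip: has_real_derivative_iff_has_vector_derivative simp del: of_nat_Suc)
    have "((\<lambda>\<tau>. cos (real k * pi / 2) * (cos \<tau> * sin \<tau> ^ k)
         - cos (real (Suc 0) * \<tau> - real k * pi / 2) * sin \<tau> ^ k)
        has_integral cos (real k * pi / 2) * (sin pi ^ Suc k / real (Suc k) - sin 0 ^ Suc k / real (Suc k))
           - pi * taylor Bessel k (Suc 0)) {0..pi}"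
      by (intro has_integral_mult_right has_integral_diff Suc 1)
    also have "(\<lambda>\<tau>. cos (real k * pi / 2) * (cos \<tau> * sin \<tau> ^ k)
         - cos (real (Suc 0) * \<tau> - real k * pi / 2) * sin \<tau> ^ k) =
        (\<lambda>\<tau>. cos (real l * \<tau> - real (Suc k) * pi / 2) * sin \<tau> ^ Suc k)"
    proof
      fix \<tau> :: real
      have *: "real (Suc k) * pi / 2 = real k * pi / 2 + pi / 2" by (simp add: field_simps)
      show "cos (real k * pi / 2) * (cos \<tau> * sin \<tau> ^ k)
         - cos (real (Suc 0) * \<tau> - real k * pi / 2) * sin \<tau> ^ k =
        cos (real l * \<tau> - real (Suc k) * pi / 2) * sin \<tau> ^ Suc k"
        unfolding * True by (simp add: cos_diff cos_add algebra_simps)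
    qed
    finally show ?thesis using True by simp
  qed
qed

text \<open>Termwise integration of the cosine series is allowed because it is dominated, uniformly in \<open>\<tau>\<close>,
  by the exponential series of \<open>\<bar>z\<bar>\<close>.\<close>

lemma bessel_J_sums:
  "(\<lambda>k. complex_of_real (taylor Bessel k l) * z ^ k / fact k) sums bessel_J l z"
proof -
  define f where "f = (\<lambda>k \<tau>. complex_of_real (cos (real l * \<tau> - real k * pi / 2) * sin \<tau> ^ k) * (z ^ k / fact k))"
  define F where "F = (\<lambda>\<tau>. cos (of_nat l * complex_of_real \<tau> - z * of_real (sin \<tau>)))"
  have f_sums: "(\<lambda>k. f k \<tau>) sums F \<tau>" for \<tau>
    using cos_diff_sums[of "real l * \<tau>" "z * of_real (sin \<tau>)"]
    by (simp add: f_def F_def power_mult_distrib mult_ac)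
  have "uniform_limit {0..pi} (\<lambda>n \<tau>. \<Sum>k<n. f k \<tau>) (\<lambda>\<tau>. suminf (\<lambda>k. f k \<tau>)) sequentially"
  proof (rule Weierstrass_m_test)
    fix k \<tau>
    have "\<bar>cos (real l * \<tau> - real k * pi / 2)\<bar> * \<bar>sin \<tau>\<bar> ^ k \<le> 1 * 1"
      by (intro mult_mono power_le_one) auto
    then show "cmod (f k \<tau>) \<le> cmod z ^ k / fact k"
      unfolding f_def norm_mult norm_divide norm_power norm_of_real abs_mult power_abs norm_fact
      by (intro mult_left_le_one_le) auto
  next
    show "summable (\<lambda>k. cmod z ^ k / fact k)"
      using summable_exp[of "cmod z"] by (simp add: field_simps)
  qed
  also have "(\<lambda>\<tau>. suminf (\<lambda>k. f k \<tau>)) = F" using f_sums by (auto simp: sums_iff)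
  finally have unif: "uniform_limit {0..pi} (\<lambda>n \<tau>. \<Sum>k<n. f k \<tau>) F sequentially" .
  obtain I J where I: "\<And>n. ((\<lambda>\<tau>. \<Sum>k<n. f k \<tau>) has_integral I n) {0..pi}"
    and J: "(F has_integral J) {0..pi}" and lim: "I \<longlonglongrightarrow> J"
    by (rule uniform_limit_integral[OF unif]) (auto simp: f_def intro!: continuous_intros)
  have "(f k has_integral complex_of_real (pi * taylor Bessel k l) * (z ^ k / fact k)) {0..pi}" for k
    unfolding f_def using has_integral_taylor_Bessel[of l k]
    by (intro has_integral_mult_left has_integral_of_real)
  then have "((\<lambda>\<tau>. \<Sum>k<n. f k \<tau>) has_integral
      (\<Sum>k<n. complex_of_real (pi * taylor Bessel k l) * (z ^ k / fact k))) {0..pi}" for n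
    by (intro has_integral_sum) auto
  then have "I = (\<lambda>n. \<Sum>k<n. complex_of_real (pi * taylor Bessel k l) * (z ^ k / fact k))"
    using I has_integral_unique by blast
  with lim have "(\<lambda>k. complex_of_real (pi * taylor Bessel k l) * (z ^ k / fact k)) sums J"
    by (simp add: sums_def)
  from sums_mult[OF this, of "1 / of_real pi"]
  show ?thesis using integral_unique[OF J] by (simp add: bessel_J_def F_def)
qed

lemma basis_fun_sums:
  "(\<lambda>k. complex_of_real (taylor kind k l) * z ^ k / fact k) sums basis_fun kind l z"
proof (cases kind)
  case Monomials
  have "(\<lambda>k. complex_of_real (taylor Monomials k l) * z ^ k / fact k) =
      (\<lambda>k. if k = l then z ^ k / fact k else 0)"
    by (auto simp: taylor_Monomials)
  then show ?thesis using sums_single[of l "\<lambda>k. z ^ k / fact k"] Monomials by simp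
next
  case Bessel
  then show ?thesis using bessel_J_sums by simp
next
  case Modified_Bessel
  have "(- \<i>) ^ l * (complex_of_real (taylor Bessel k l) * (\<i> * z) ^ k / fact k) =
      complex_of_real (taylor Modified_Bessel k l) * z ^ k / fact k" for k
  proof -
    have "(- \<i>) ^ l * (complex_of_real (taylor Bessel k l) * (\<i> * z) ^ k / fact k) =
      (- \<i>) ^ l * (\<i> ^ k * complex_of_real (taylor Bessel k l)) * z ^ k / fact k"
      by (simp add: power_mult_distrib)
    also have "\<dots> = ((- \<i>) * \<i>) ^ l * complex_of_real (taylor Modified_Bessel k l) * z ^ k / fact k"
      unfolding taylor_Bessel_Modified power_mult_distrib by simp
    finally show ?thesis by simp
  qed
  then show ?thesis
    using sums_mult[OF bessel_J_sums[of l "\<i> * z"], of "(- \<i>) ^ l"] Modified_Bessel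
    by (simp add: bessel_I_def)
qed

section \<open>Derivatives of a function expanded in the basis\<close>

definition majorant :: "basis_kind \<Rightarrow> nat \<Rightarrow> real \<Rightarrow> real" where
  "majorant kind l x = (\<Sum>k. \<bar>taylor kind k l\<bar> * x ^ k / fact k)"

lemma summable_majorant:
  assumes "x \<ge> 0"
  shows "summable (\<lambda>k. \<bar>taylor kind k l\<bar> * x ^ k / fact k)"
proof (rule summable_comparison_test')
  show "summable (\<lambda>k. x ^ k / fact k)"
    using summable_exp[of x] by (simp add: field_simps)
  show "norm (\<bar>taylor kind k l\<bar> * x ^ k / fact k) \<le> x ^ k / fact k" for k
    using assms abs_taylor_le_1[of kind k l]
    by (simp add: divide_right_mono mult_left_le_one_le)
qed

text \<open>The Taylor terms of \<open>\<phi>\<^sub>l\<close> are aligned on the positive real axis for monomials and modified Bessel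
  functions and on the positive imaginary axis for Bessel functions. The direction does not depend on \<open>l\<close>, which is what
  turns convergence at a single point into a bound on all coefficients.\<close>

lemma majorant_attained:
  obtains \<eta> where "\<And>l x. x \<ge> 0 \<Longrightarrow> cmod (basis_fun kind l (\<eta> * of_real x)) = majorant kind l x"
proof -
  \<comment> \<open>\<open>\<eta>\<close> spans the ray along which the Taylor terms are aligned.\<close>
  define \<eta> where "\<eta> = (if kind = Bessel then \<i> else 1)"
  have rot: "\<eta> ^ k * complex_of_real (taylor kind k l) = \<eta> ^ l * of_real \<bar>taylor kind k l\<bar>" for k l
  proof (cases kind)
    case Monomials
    then show ?thesis by (auto simp: \<eta>_def taylor_Monomials)
  next
    case Bessel
    then show ?thesis using taylor_Bessel_Modified[of k l] by (simp add: \<eta>_def abs_taylor_Bessel)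
  next
    case Modified_Bessel
    then show ?thesis using taylor_Modified_Bessel_nonneg[of k l] by (simp add: \<eta>_def)
  qed
  have "cmod (basis_fun kind l (\<eta> * of_real x)) = majorant kind l x" if x: "x \<ge> 0" for l x
  proof -
    have "(\<lambda>k. complex_of_real (taylor kind k l) * (\<eta> * of_real x) ^ k / fact k) =
        (\<lambda>k. \<eta> ^ l * of_real (\<bar>taylor kind k l\<bar> * x ^ k / fact k))"
    proof
      fix k
      have "complex_of_real (taylor kind k l) * (\<eta> * of_real x) ^ k / fact k =
         (\<eta> ^ k * complex_of_real (taylor kind k l)) * of_real x ^ k / fact k"
        by (simp add: power_mult_distrib)
      then show "complex_of_real (taylor kind k l) * (\<eta> * of_real x) ^ k / fact k =
         \<eta> ^ l * of_real (\<bar>taylor kind k l\<bar> * x ^ k / fact k)"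
        unfolding rot by simp
    qed
    moreover have "(\<lambda>k. \<eta> ^ l * complex_of_real (\<bar>taylor kind k l\<bar> * x ^ k / fact k)) sums
        (\<eta> ^ l * of_real (majorant kind l x))"
      unfolding majorant_def using summable_majorant[OF x]
      by (intro sums_mult sums_of_real summable_sums)
    ultimately have "basis_fun kind l (\<eta> * of_real x) = \<eta> ^ l * of_real (majorant kind l x)"
      using basis_fun_sums[of kind l "\<eta> * of_real x"] sums_unique2 by metis
    moreover have "majorant kind l x \<ge> 0"
      unfolding majorant_def using x by (intro suminf_nonneg summable_majorant) auto
    ultimately show ?thesis by (simp add: norm_mult norm_power \<eta>_def)
  qed
  then show ?thesis by (rule that)
qed

text \<open>The Taylor series of \<open>\<phi>\<^sub>l\<close> starts with the power \<open>l\<close>, so shrinking the argument gains a geometric factor.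
  This replaces any asymptotics of Bessel functions for large order.\<close>

lemma majorant_le_power:
  assumes "0 \<le> r" "r \<le> x" "0 < x"
  shows "majorant kind l r \<le> (r / x) ^ l * majorant kind l x"
proof -
  have "\<bar>taylor kind k l\<bar> * r ^ k / fact k \<le> (r / x) ^ l * (\<bar>taylor kind k l\<bar> * x ^ k / fact k)" for k
  proof (cases "k < l")
    case False
    have "r ^ k = (r / x) ^ k * x ^ k" using assms by (simp add: power_divide)
    also have "\<dots> \<le> (r / x) ^ l * x ^ k"
      using assms False by (intro mult_right_mono power_decreasing) auto
    finally have "\<bar>taylor kind k l\<bar> / fact k * r ^ k \<le> \<bar>taylor kind k l\<bar> / fact k * ((r / x) ^ l * x ^ k)"
      by (intro mult_left_mono) auto
    then show ?thesis by (simp add: mult_ac)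
  qed (simp add: taylor_upper_zero)
  then have "majorant kind l r \<le> (\<Sum>k. (r / x) ^ l * (\<bar>taylor kind k l\<bar> * x ^ k / fact k))"
    unfolding majorant_def using assms
    by (intro suminf_le summable_majorant summable_mult) auto
  also have "\<dots> = (r / x) ^ l * majorant kind l x"
    unfolding majorant_def using assms by (intro suminf_mult summable_majorant) auto
  finally show ?thesis .
qed

lemma sums_triangular_swap:
  fixes a :: "nat \<Rightarrow> nat \<Rightarrow> complex"
  assumes tri: "\<And>l k. k < l \<Longrightarrow> a l k = 0"
    and rows: "\<And>l. summable (\<lambda>k. cmod (a l k))"
    and norms: "summable (\<lambda>l. \<Sum>k. cmod (a l k))"
    and S: "(\<lambda>l. \<Sum>k. a l k) sums S"
  shows "(\<lambda>k. \<Sum>l\<le>k. a l k) sums S"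
proof -
  have "(\<lambda>(l, k). cmod (a l k)) summable_on UNIV \<times> UNIV"
  proof (rule summable_on_SigmaI)
    show "((\<lambda>k. case (l, k) of (l, k) \<Rightarrow> cmod (a l k)) has_sum (\<Sum>k. cmod (a l k))) UNIV" for l
      using rows[of l] by (auto intro!: norm_summable_imp_has_sum summable_sums)
    show "(\<lambda>l. \<Sum>k. cmod (a l k)) summable_on UNIV"
      using norms suminf_nonneg[OF rows]
      by (intro norm_summable_imp_summable_on) simp
  qed auto
  then have "(\<lambda>p. norm (case p of (l, k) \<Rightarrow> a l k)) summable_on UNIV \<times> UNIV"
    by (simp add: case_prod_unfold)
  from abs_summable_summable[OF this] obtain T
    where T: "((\<lambda>(l, k). a l k) has_sum T) (UNIV \<times> UNIV)" by (auto simp: summable_on_def)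
  have "((\<lambda>l. \<Sum>k. a l k) has_sum T) UNIV"
  proof (rule has_sum_SigmaD[OF T])
    show "((\<lambda>k. case (l, k) of (l, k) \<Rightarrow> a l k) has_sum (\<Sum>k. a l k)) UNIV" for l
      using rows[of l] by (auto intro!: norm_summable_imp_has_sum summable_sums summable_norm_cancel)
  qed
  from has_sum_imp_sums[OF this] have "T = S" using S sums_unique2 by blast
  have T': "((\<lambda>(k, l). a l k) has_sum T) (UNIV \<times> UNIV)"
    using has_sum_swap[where f = "\<lambda>(l, k). a l k" and S = T and A = UNIV and B = UNIV] T by simp
  have "((\<lambda>k. \<Sum>l\<le>k. a l k) has_sum T) UNIV"
  proof (rule has_sum_SigmaD[OF T'])
    show "((\<lambda>l. case (k, l) of (k, l) \<Rightarrow> a l k) has_sum (\<Sum>l\<le>k. a l k)) UNIV" for k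
      using tri by (intro has_sum_finite_neutralI[of "{..k}"]) (auto simp: not_le)
  qed
  from has_sum_imp_sums[OF this] show ?thesis using \<open>T = S\<close> by simp
qed

text \<open>At the point of modulus \<open>1\<close> where the majorants are attained, convergence bounds
  \<open>\<bar>c\<^sub>l\<bar> majorant l 1\<close>. For \<open>\<bar>s\<bar> < 1\<close> the double series of \<open>c\<^sub>l\<close> times the Taylor terms of \<open>\<phi>\<^sub>l(s)\<close> is then
  absolutely summable, and collecting the powers of \<open>s\<close> gives the Taylor series of \<open>f\<close>.\<close>

lemma higher_deriv_basis_expansion:
  fixes f :: "complex \<Rightarrow> complex"
  assumes f: "\<And>s. (\<lambda>l. c l * basis_fun kind l s) sums f s"
  shows "(deriv ^^ k) f 0 = (\<Sum>l\<le>k. c l * of_real (taylor kind k l))"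
proof -
  obtain \<eta> where \<eta>: "\<And>l x. x \<ge> 0 \<Longrightarrow> cmod (basis_fun kind l (\<eta> * of_real x)) = majorant kind l x"
    using majorant_attained by blast
  have "(\<lambda>l. c l * basis_fun kind l (\<eta> * of_real 1)) \<longlonglongrightarrow> 0"
    using f sums_summable summable_LIMSEQ_zero by blast
  then have "Bseq (\<lambda>l. c l * basis_fun kind l (\<eta> * of_real 1))"
    using convergentI convergent_imp_Bseq by blast
  then obtain K where K: "cmod (c l * basis_fun kind l (\<eta> * of_real 1)) \<le> K" for l
    by (auto simp: Bseq_def)
  then have K: "cmod (c l) * majorant kind l 1 \<le> K" for l
    using \<eta>[of 1 l] unfolding norm_mult by (metis zero_le_one)
  have "(\<lambda>k. \<Sum>l\<le>k. c l * of_real (taylor kind k l) * s ^ k / fact k) sums f s"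
    if s: "cmod s < 1" for s
  proof (rule sums_triangular_swap)
    define a where "a = (\<lambda>l k. c l * of_real (taylor kind k l) * s ^ k / fact k)"
    have sum_a: "(\<lambda>k. a l k) sums (c l * basis_fun kind l s)" for l
      using sums_mult[OF basis_fun_sums[of kind l s], of "c l"] by (simp add: a_def mult_ac)
    have na: "cmod (a l k) = cmod (c l) * (\<bar>taylor kind k l\<bar> * cmod s ^ k / fact k)" for l k
      by (simp add: a_def norm_mult norm_divide norm_power mult_ac)
    show sn: "summable (\<lambda>k. cmod (a l k))" for l
      unfolding na by (intro summable_mult summable_majorant) simp
    have row: "(\<Sum>k. cmod (a l k)) = cmod (c l) * majorant kind l (cmod s)" for l
      unfolding na majorant_def by (intro suminf_mult summable_majorant) simp
    show "summable (\<lambda>l. \<Sum>k. cmod (a l k))"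
    proof (rule summable_comparison_test')
      show "summable (\<lambda>l. K * cmod s ^ l)"
        using s by (intro summable_mult summable_geometric) simp
      fix l
      have "cmod (c l) * majorant kind l (cmod s) \<le> cmod (c l) * ((cmod s / 1) ^ l * majorant kind l 1)"
        using s by (intro mult_left_mono majorant_le_power) auto
      also have "\<dots> \<le> K * cmod s ^ l"
        using mult_right_mono[OF K[of l], of "cmod s ^ l"] by (simp add: mult_ac)
      finally show "norm (\<Sum>k. cmod (a l k)) \<le> K * cmod s ^ l"
        using suminf_nonneg[OF sn[of l]] unfolding row by simp
    qed
    show "(\<lambda>l. \<Sum>k. a l k) sums f s" using f[of s] sum_a by (simp add: sums_iff)
    show "a l k = 0" if "k < l" for l k using that by (simp add: a_def taylor_upper_zero)
  qed
  then have "\<forall>\<^sub>F s in nhds 0. (\<lambda>k. fps_nth (Abs_fps (\<lambda>k. (\<Sum>l\<le>k. c l * of_real (taylor kind k l)) / fact k)) k * s ^ k) sums f s"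
    by (intro eventually_nhds_in_open[of "ball 0 1", THEN eventually_mono])
      (auto simp: sum_divide_distrib sum_distrib_right)
  from fps_nth_fps_expansion[OF has_fps_expansionI[OF this], of k]
  show ?thesis by (simp add: field_simps)
qed

section \<open>Linear recurrences and Krylov sequences\<close>

text \<open>With the shift \<open>E\<close> on sequences, \<open>recurrence_op cs\<close> is the operator \<open>\<Prod>\<^sub>c (E - c)\<close>; the sequences that it maps
  to \<open>0\<close> are the solutions of the linear recurrence with characteristic roots \<open>cs\<close>.\<close>

primrec recurrence_op :: "'a::comm_ring_1 list \<Rightarrow> (nat \<Rightarrow> 'a) \<Rightarrow> nat \<Rightarrow> 'a" where
  "recurrence_op [] x = x"
| "recurrence_op (c # cs) x = recurrence_op cs (\<lambda>l. x (Suc l) - c * x l)"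

text \<open>Splitting off one root \<open>c\<close>, the sequence \<open>y = (E - c) x\<close> solves a recurrence of smaller order with initial
  bound \<open>(1 + C) B\<close>, and \<open>x\<close> is recovered from \<open>x\<^sub>l\<^sub>+\<^sub>1 = c x\<^sub>l + y\<^sub>l\<close>; the factor \<open>1 + C\<close> is exactly what
  one step of this costs.\<close>

lemma recurrence_bound:
  fixes x :: "nat \<Rightarrow> complex"
  assumes "\<And>c. c \<in> set cs \<Longrightarrow> cmod c \<le> C" and "C \<ge> 0" and "B \<ge> 0"
    and "\<And>k. k < length cs \<Longrightarrow> cmod (x k) \<le> B"
    and "\<And>l. recurrence_op cs x l = 0"
  shows "cmod (x l) \<le> B * (1 + C) ^ (length cs + l)"
  using assms
proof (induction cs arbitrary: x B l)
  case Nil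
  then show ?case by simp
next
  case (Cons c cs)
  define y where "y = (\<lambda>l. x (Suc l) - c * x l)"
  have c: "cmod c \<le> C" using Cons.prems by simp
  have y: "cmod (y l) \<le> (B * (1 + C)) * (1 + C) ^ (length cs + l)" for l
  proof (rule Cons.IH)
    fix k assume k: "k < length cs"
    have "cmod (y k) \<le> cmod (x (Suc k)) + cmod c * cmod (x k)"
      unfolding y_def by (metis norm_mult norm_triangle_ineq4)
    also have "\<dots> \<le> B + C * B"
      using k Cons.prems by (intro add_mono mult_mono) auto
    finally show "cmod (y k) \<le> B * (1 + C)" by (simp add: algebra_simps)
  qed (use Cons.prems in \<open>auto simp: y_def\<close>)
  show ?case
  proof (induction l)
    case 0
    have "cmod (x 0) \<le> B" using Cons.prems by simp
    also have "\<dots> \<le> B * (1 + C) ^ (length (c # cs) + 0)"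
      using Cons.prems mult_left_mono[OF one_le_power[of "1 + C" "length (c # cs) + 0"], of B]
      by simp
    finally show ?case .
  next
    case (Suc l)
    let ?T = "B * (1 + C) ^ (length (c # cs) + l)"
    have "cmod (x (Suc l)) = cmod (c * x l + y l)" by (simp add: y_def)
    also have "\<dots> \<le> cmod c * cmod (x l) + cmod (y l)"
      by (metis norm_mult norm_triangle_ineq)
    also have "\<dots> \<le> C * ?T + ?T"
      using c Suc y[of l] Cons.prems by (intro add_mono mult_mono) (auto simp: mult_ac)
    finally show ?case by (simp add: algebra_simps)
  qed
qed

lemma recurrence_op_append: "recurrence_op (as @ bs) x = recurrence_op bs (recurrence_op as x)"
  by (induction as arbitrary: x) auto

text \<open>The factors \<open>E - c\<close> commute; moving a single one from the end to the front is the case that is needed.\<close>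

lemma recurrence_op_snoc: "recurrence_op (cs @ [c]) x = recurrence_op (c # cs) x"
  by (induction cs arbitrary: x) (auto simp: algebra_simps)

lemma recurrence_op_sum:
  "recurrence_op cs (\<lambda>l. \<Sum>a\<in>S. \<alpha> a * x a l) = (\<lambda>l. \<Sum>a\<in>S. \<alpha> a * recurrence_op cs (x a) l)"
proof (induction cs arbitrary: x)
  case (Cons c cs)
  have "(\<lambda>l. (\<Sum>a\<in>S. \<alpha> a * x a (Suc l)) - c * (\<Sum>a\<in>S. \<alpha> a * x a l)) =
        (\<lambda>l. \<Sum>a\<in>S. \<alpha> a * (x a (Suc l) - c * x a l))"
    by (simp add: sum_distrib_left right_diff_distrib mult.left_commute sum_subtractf)
  then show ?case by (simp add: Cons.IH)
qed simp

lemma pow_mat_Suc_vec: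
  fixes M :: "'a::comm_ring_1 mat"
  assumes "M \<in> carrier_mat m m" "v \<in> carrier_vec m"
  shows "(M ^\<^sub>m Suc k) *\<^sub>v v = M *\<^sub>v ((M ^\<^sub>m k) *\<^sub>v v)"
proof -
  have "M ^\<^sub>m k * M = M * M ^\<^sub>m k"
  proof (induction k)
    case (Suc k)
    have "M ^\<^sub>m Suc k * M = (M * M ^\<^sub>m k) * M" by (simp add: Suc)
    also have "\<dots> = M * (M ^\<^sub>m Suc k)"
      using assms by (simp add: assoc_mult_mat[OF _ pow_carrier_mat])
    finally show ?case .
  qed (use assms in simp)
  then show ?thesis using assms by (simp add: assoc_mult_mat_vec[OF _ pow_carrier_mat])
qed

text \<open>The theorem of Cayley and Hamilton for a triangular matrix. Row \<open>a\<close> of \<open>B\<^sup>l\<^sup>+\<^sup>1 v = B (B\<^sup>l v)\<close> shows that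
  \<open>E - B\<^sub>a\<^sub>a\<close> turns component \<open>a\<close> into a combination of later components, which the factors of the later
  diagonal entries annihilate.\<close>

lemma upper_triangular_krylov_recurrence:
  fixes B :: "'a::comm_ring_1 mat"
  assumes B: "B \<in> carrier_mat m m" "upper_triangular B" and v: "v \<in> carrier_vec m"
    and "k \<le> m" "m - k \<le> a" "a < m"
  shows "recurrence_op (map (\<lambda>j. B $$ (j, j)) (rev [m - k..<m])) (\<lambda>l. ((B ^\<^sub>m l) *\<^sub>v v) $ a) = (\<lambda>_. 0)"
  using assms(4-6)
proof (induction k arbitrary: a)
  case (Suc k)
  define r where "r = m - Suc k"
  define x where "x = (\<lambda>a l. ((B ^\<^sub>m l) *\<^sub>v v) $ a)"
  let ?L = "map (\<lambda>j. B $$ (j, j)) (rev [m - k..<m])"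
  have r: "m - k = Suc r" "r < m" using Suc.prems by (auto simp: r_def)
  have L: "map (\<lambda>j. B $$ (j, j)) (rev [m - Suc k..<m]) = ?L @ [B $$ (r, r)]"
    using r by (simp add: r_def[symmetric] upt_conv_Cons)
  have IH: "recurrence_op ?L (x a) = (\<lambda>_. 0)" if "Suc r \<le> a" "a < m" for a
    unfolding x_def using that r Suc.prems by (intro Suc.IH) auto
  show ?case
  proof (cases "a = r")
    case False
    then have "Suc r \<le> a" using Suc.prems r by simp
    then show ?thesis
      unfolding L using IH[of a] Suc.prems by (simp add: recurrence_op_append x_def)
  next
    case True
    have "x r (Suc l) = (\<Sum>b = 0..<m. B $$ (r, b) * x b l)" for l
      unfolding x_def pow_mat_Suc_vec[OF B(1) v]
      using B v r by (simp add: scalar_prod_def)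
    also have "(\<Sum>b = 0..<m. B $$ (r, b) * x b l) =
        (\<Sum>b = r..<m. B $$ (r, b) * x b l)" for l
      using B(1) r upper_triangularD[OF B(2)]
      by (intro sum.mono_neutral_right) auto
    also have "(\<Sum>b = r..<m. B $$ (r, b) * x b l) =
        B $$ (r, r) * x r l + (\<Sum>b = Suc r..<m. B $$ (r, b) * x b l)" for l
      using r by (simp add: sum.atLeast_Suc_lessThan)
    finally have "(\<lambda>l. x r (Suc l) - B $$ (r, r) * x r l) =
        (\<lambda>l. \<Sum>b = Suc r..<m. B $$ (r, b) * x b l)" by simp
    then have "recurrence_op (?L @ [B $$ (r, r)]) (x r) =
        (\<lambda>l. \<Sum>b = Suc r..<m. B $$ (r, b) * recurrence_op ?L (x b) l)"
      unfolding recurrence_op_snoc by (simp add: recurrence_op_sum)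
    then show ?thesis unfolding L using IH True by (simp add: x_def)
  qed
qed simp

text \<open>A Schur decomposition reduces the recurrence for \<open>M\<close> to the triangular case; its roots are the eigenvalues of
  \<open>M\<close>. The bound sees the spectrum of \<open>M\<close> and the first
  \<open>m\<close> terms, but not the norms of \<open>M\<close> and \<open>L\<close>.\<close>

lemma krylov_bound:
  fixes M :: "complex mat"
  assumes M: "M \<in> carrier_mat m m" and L: "L \<in> carrier_mat p m" and u: "u \<in> carrier_vec m"
    and i: "i < p"
    and ev: "\<And>e. eigenvalue M e \<Longrightarrow> cmod e \<le> C" and "C \<ge> 0" and "B \<ge> 0"
    and small: "\<And>k. k < m \<Longrightarrow> cmod ((L *\<^sub>v ((M ^\<^sub>m k) *\<^sub>v u)) $ i) \<le> B"
  shows "cmod ((L *\<^sub>v ((M ^\<^sub>m l) *\<^sub>v u)) $ i) \<le> B * (1 + C) ^ (m + l)"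
proof -
  obtain es where es: "char_poly M = (\<Prod>e\<leftarrow>es. [:- e, 1:])" and len: "length es = m"
    using char_poly_factorized[OF M] by blast
  obtain T P P' where "schur_decomposition M es = (T, P, P')"
    by (cases "schur_decomposition M es") auto
  from schur_decomposition[OF M es this]
  have wit: "similar_mat_wit M T P P'" and T: "upper_triangular T" "diag_mat T = es" by auto
  note car = similar_mat_witD2[OF M wit]
  define cs where "cs = map (\<lambda>j. T $$ (j, j)) (rev [0..<m])"
  have cs: "cs = rev es" using T car by (auto simp: cs_def diag_mat_def simp flip: rev_map)
  define v where "v = P' *\<^sub>v u"
  have v: "v \<in> carrier_vec m" using car u by (simp add: v_def)
  have x: "(L *\<^sub>v ((M ^\<^sub>m l) *\<^sub>v u)) $ i = (\<Sum>a = 0..<m. (L * P) $$ (i, a) * ((T ^\<^sub>m l) *\<^sub>v v) $ a)" for l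
  proof -
    have "M ^\<^sub>m l = P * T ^\<^sub>m l * P'" by (rule similar_mat_wit_pow_id[OF wit])
    moreover have Tl: "T ^\<^sub>m l \<in> carrier_mat m m" using car by simp
    ultimately have "(M ^\<^sub>m l) *\<^sub>v u = P *\<^sub>v ((T ^\<^sub>m l) *\<^sub>v v)"
      using assoc_mult_mat_vec[OF mult_carrier_mat[OF car(6) Tl] car(7) u]
        assoc_mult_mat_vec[OF car(6) Tl v] by (simp only: v_def)
    then have "L *\<^sub>v ((M ^\<^sub>m l) *\<^sub>v u) = (L * P) *\<^sub>v ((T ^\<^sub>m l) *\<^sub>v v)"
      using assoc_mult_mat_vec[OF L car(6) mult_mat_vec_carrier[OF Tl v]] by simp
    moreover have "dim_vec ((T ^\<^sub>m l) *\<^sub>v v) = m" using car by simp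
    ultimately show ?thesis using i L car by (simp add: scalar_prod_def)
  qed
  have "recurrence_op cs (\<lambda>l. (L *\<^sub>v ((M ^\<^sub>m l) *\<^sub>v u)) $ i) =
      (\<lambda>l. \<Sum>a = 0..<m. (L * P) $$ (i, a) * recurrence_op cs (\<lambda>l. ((T ^\<^sub>m l) *\<^sub>v v) $ a) l)"
    unfolding x by (rule recurrence_op_sum)
  also have "\<dots> = (\<lambda>_. 0)"
    using upper_triangular_krylov_recurrence[OF car(5) T(1) v, of m] by (auto simp: cs_def)
  finally have ann: "recurrence_op cs (\<lambda>l. (L *\<^sub>v ((M ^\<^sub>m l) *\<^sub>v u)) $ i) = (\<lambda>_. 0)" .
  have "cmod c \<le> C" if "c \<in> set cs" for c
  proof (rule ev)
    have "poly (char_poly M) c = 0" unfolding es using that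
      by (force simp: cs poly_prod_list prod_list_zero_iff)
    then show "eigenvalue M c" using eigenvalue_root_char_poly[OF M] by simp
  qed
  then show ?thesis
    using recurrence_bound[of cs C B "\<lambda>l. (L *\<^sub>v ((M ^\<^sub>m l) *\<^sub>v u)) $ i" l] ann small assms(6,7) cs len
    by simp
qed

section \<open>Norms, eigenvalues and matrix power series\<close>

lemma mult_mat_vec_index_sum:
  assumes "M \<in> carrier_mat p m" "v \<in> carrier_vec m" "i < p"
  shows "(M *\<^sub>v v) $ i = (\<Sum>j<m. M $$ (i, j) * v $ j)"
  using assms by (simp add: scalar_prod_def lessThan_atLeast0)

lemma l2_norm_nonneg: "0 \<le> l2_norm v"
  by (simp add: l2_norm_def L2_set_nonneg)

lemma cmod_le_l2_norm: "i < dim_vec v \<Longrightarrow> cmod (v $ i) \<le> l2_norm v"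
  unfolding l2_norm_def by (rule member_le_L2_set) auto

lemma l2_norm_le_sum: "l2_norm v \<le> (\<Sum>i<dim_vec v. cmod (v $ i))"
  unfolding l2_norm_def by (rule L2_set_le_sum) simp

lemma l2_norm_le_uniform:
  assumes "v \<in> carrier_vec n" "\<And>i. i < n \<Longrightarrow> cmod (v $ i) \<le> b"
  shows "l2_norm v \<le> real n * b"
proof -
  have "l2_norm v \<le> (\<Sum>i<n. cmod (v $ i))" using l2_norm_le_sum[of v] assms(1) by simp
  also have "\<dots> \<le> real n * b" using sum_bounded_above[of "{..<n}" "\<lambda>i. cmod (v $ i)" b] assms(2) by simp
  finally show ?thesis .
qed

lemma l2_norm_smult: "l2_norm (c \<cdot>\<^sub>v v) = cmod c * l2_norm v"
proof -
  have "l2_norm (c \<cdot>\<^sub>v v) = L2_set (\<lambda>i. cmod c * cmod (v $ i)) {..<dim_vec v}"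
    unfolding l2_norm_def by (intro L2_set_cong) (auto simp: norm_mult)
  then show ?thesis by (simp add: l2_norm_def L2_set_right_distrib)
qed

lemma l2_norm_eq_0_iff: "v \<in> carrier_vec m \<Longrightarrow> l2_norm v = 0 \<longleftrightarrow> v = 0\<^sub>v m"
  by (auto simp: l2_norm_def L2_set_eq_0_iff vec_eq_iff)

lemma cscalar_prod_eq_sum: "dim_vec w = m \<Longrightarrow> v \<bullet>c w = (\<Sum>i<m. v $ i * cnj (w $ i))"
  by (simp add: scalar_prod_def lessThan_atLeast0)

lemma cscalar_prod_self: "v \<bullet>c v = complex_of_real ((l2_norm v)\<^sup>2)"
proof -
  have "(l2_norm v)\<^sup>2 = (\<Sum>i<dim_vec v. (cmod (v $ i))\<^sup>2)"
    by (simp add: l2_norm_def L2_set_def sum_nonneg)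
  then show ?thesis by (simp add: cscalar_prod_eq_sum flip: complex_norm_square)
qed

lemma normalize_vec_carrier [simp]: "v \<in> carrier_vec m \<Longrightarrow> normalize_vec v \<in> carrier_vec m"
  by (simp add: normalize_vec_def)

lemma normalize_vec_index:
  "i < dim_vec v \<Longrightarrow> normalize_vec v $ i = complex_of_real (1 / l2_norm v) * v $ i"
  by (simp add: normalize_vec_def)

lemma normalize_vec_zero: "normalize_vec (0\<^sub>v m) = 0\<^sub>v m"
  by (auto simp: normalize_vec_def)

lemma normalize_vec_unit:
  assumes "v \<in> carrier_vec m" "v \<noteq> 0\<^sub>v m"
  shows "normalize_vec v \<bullet>c normalize_vec v = 1"
proof -
  have "normalize_vec v \<bullet>c normalize_vec v =
      (\<Sum>i<m. (complex_of_real (1 / l2_norm v))\<^sup>2 * (v $ i * cnj (v $ i)))"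
    using assms by (subst cscalar_prod_eq_sum[of _ m]) (auto simp: normalize_vec_def power2_eq_square mult_ac)
  also have "\<dots> = (complex_of_real (1 / l2_norm v))\<^sup>2 * (v \<bullet>c v)"
    using assms by (subst cscalar_prod_eq_sum[of _ m]) (auto simp: sum_distrib_left)
  also have "\<dots> = 1"
    using assms l2_norm_eq_0_iff[of v m] by (simp add: cscalar_prod_self power2_eq_square)
  finally show ?thesis .
qed

lemma normalize_vec_scale:
  assumes "v \<in> carrier_vec m" "i < m" "normalize_vec v \<noteq> 0\<^sub>v m"
  shows "v $ i = complex_of_real (l2_norm v) * normalize_vec v $ i"
  using assms l2_norm_eq_0_iff[OF assms(1)] normalize_vec_zero[of m]
  by (auto simp: normalize_vec_index)

text \<open>Without this the supremum in \<open>spectral_norm\<close> would not bound anything; any bound does, here the sum of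
  the moduli of all entries.\<close>

lemma bdd_above_operator_image:
  "bdd_above ((\<lambda>v. l2_norm (M *\<^sub>v v)) ` {v \<in> carrier_vec (dim_col M). l2_norm v \<le> 1})"
proof (rule bdd_aboveI2)
  fix v assume v: "v \<in> {v \<in> carrier_vec (dim_col M). l2_norm v \<le> 1}"
  have "l2_norm (M *\<^sub>v v) \<le> (\<Sum>i<dim_row M. cmod ((M *\<^sub>v v) $ i))"
    using l2_norm_le_sum[of "M *\<^sub>v v"] by simp
  also have "\<dots> \<le> (\<Sum>i<dim_row M. \<Sum>j<dim_col M. cmod (M $$ (i, j)))"
  proof (rule sum_mono)
    fix i assume "i \<in> {..<dim_row M}"
    then have "cmod ((M *\<^sub>v v) $ i) = cmod (\<Sum>j<dim_col M. M $$ (i, j) * v $ j)"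
      using v mult_mat_vec_index_sum[of M "dim_row M" "dim_col M" v i] by simp
    also have "\<dots> \<le> (\<Sum>j<dim_col M. cmod (M $$ (i, j)))"
    proof (rule order_trans[OF norm_sum sum_mono])
      fix j assume "j \<in> {..<dim_col M}"
      then have "cmod (v $ j) \<le> 1" using v cmod_le_l2_norm[of j v] by auto
      then show "cmod (M $$ (i, j) * v $ j) \<le> cmod (M $$ (i, j))"
        by (simp add: norm_mult mult_left_le)
    qed
    finally show "cmod ((M *\<^sub>v v) $ i) \<le> (\<Sum>j<dim_col M. cmod (M $$ (i, j)))" .
  qed
  finally show "l2_norm (M *\<^sub>v v) \<le> (\<Sum>i<dim_row M. \<Sum>j<dim_col M. cmod (M $$ (i, j)))" .
qed

lemma eigenvalue_le_spectral_norm: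
  assumes M: "M \<in> carrier_mat m m" and e: "eigenvector M v e"
  shows "cmod e \<le> spectral_norm M"
proof -
  from e M have v: "v \<in> carrier_vec m" "v \<noteq> 0\<^sub>v m" and Mv: "M *\<^sub>v v = e \<cdot>\<^sub>v v"
    by (auto simp: eigenvector_def)
  have pos: "l2_norm v \<noteq> 0" using l2_norm_eq_0_iff[OF v(1)] v(2) by simp
  let ?u = "normalize_vec v"
  have u: "?u \<in> carrier_vec m" "l2_norm ?u = 1"
    using v(1) pos l2_norm_nonneg[of v] by (simp_all add: normalize_vec_def l2_norm_smult norm_divide)
  have "M *\<^sub>v ?u = e \<cdot>\<^sub>v ?u"
    unfolding normalize_vec_def using M v(1) Mv by (simp add: mult_mat_vec smult_smult_assoc mult.commute)
  then have "cmod e = l2_norm (M *\<^sub>v ?u)" using u by (simp add: l2_norm_smult)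
  also have "\<dots> \<le> spectral_norm M"
    unfolding spectral_norm_def using u M by (intro cSUP_upper bdd_above_operator_image) auto
  finally show ?thesis .
qed

lemma eigenvalue_le_of_power_norm:
  assumes M: "M \<in> carrier_mat m m" and e: "eigenvalue M e" and "N > 0"
    and le: "spectral_norm (M ^\<^sub>m N) \<le> C ^ N"
  shows "cmod e \<le> \<bar>C\<bar>"
proof -
  from e obtain v where v: "eigenvector M v e" by (auto simp: eigenvalue_def)
  from eigenvector_pow[OF M v, of N] v M have "eigenvector (M ^\<^sub>m N) v (e ^ N)"
    by (auto simp: eigenvector_def)
  from eigenvalue_le_spectral_norm[OF pow_carrier_mat[OF M] this] le
  have "cmod e ^ N \<le> C ^ N" by (simp add: norm_power)
  also have "\<dots> \<le> \<bar>C\<bar> ^ N" by (metis abs_ge_self power_abs)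
  finally show ?thesis using \<open>N > 0\<close> by (simp add: power_mono_iff)
qed

text \<open>In the eigenvalue equation, compare both sides at a component of largest modulus.\<close>

lemma eigenvalue_le_row_sum:
  assumes M: "M \<in> carrier_mat m m" and e: "eigenvalue M e"
    and rows: "\<And>i. i < m \<Longrightarrow> (\<Sum>j<m. cmod (M $$ (i, j))) \<le> C"
  shows "cmod e \<le> C"
proof -
  from e M obtain v where v: "v \<in> carrier_vec m" "v \<noteq> 0\<^sub>v m" and Mv: "M *\<^sub>v v = e \<cdot>\<^sub>v v"
    by (auto simp: eigenvalue_def eigenvector_def)
  then obtain i0 where i0: "i0 < m" "v $ i0 \<noteq> 0" by (metis carrier_vecD eq_vecI index_zero_vec)
  have "\<exists>i<m. \<forall>j<m. cmod (v $ j) \<le> cmod (v $ i)"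
  proof -
    let ?I = "(\<lambda>j. cmod (v $ j)) ` {..<m}"
    have "Max ?I \<in> ?I" using i0 by (intro Max_in) auto
    then obtain i where "i < m" "cmod (v $ i) = Max ?I" by auto
    then show ?thesis by (intro exI[of _ i]) auto
  qed
  then obtain i where i: "i < m" "\<And>j. j < m \<Longrightarrow> cmod (v $ j) \<le> cmod (v $ i)" by blast
  have pos: "cmod (v $ i) > 0" using i(2)[OF i0(1)] i0(2) by (smt (verit) zero_less_norm_iff)
  have "cmod e * cmod (v $ i) = cmod ((M *\<^sub>v v) $ i)"
    using i v by (simp add: Mv norm_mult)
  also have "\<dots> = cmod (\<Sum>j<m. M $$ (i, j) * v $ j)"
    using mult_mat_vec_index_sum[OF M v(1) i(1)] by simp
  also have "\<dots> \<le> (\<Sum>j<m. cmod (M $$ (i, j)) * cmod (v $ i))"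
    by (rule order_trans[OF norm_sum sum_mono]) (auto simp: norm_mult intro!: mult_left_mono i(2))
  also have "\<dots> \<le> C * cmod (v $ i)"
    unfolding sum_distrib_right[symmetric] using rows[OF i(1)] by (intro mult_right_mono) auto
  finally show ?thesis using pos by simp
qed

lemma pow_mat_entry_bound:
  fixes M :: "complex mat"
  assumes M: "M \<in> carrier_mat m m" and ij: "i < m" "j < m"
  shows "cmod ((M ^\<^sub>m k) $$ (i, j)) \<le> (\<Sum>i<m. \<Sum>j<m. cmod (M $$ (i, j))) ^ k"
  using ij
proof (induction k arbitrary: j)
  case (Suc k)
  let ?K = "\<Sum>i<m. \<Sum>j<m. cmod (M $$ (i, j))"
  have K: "?K \<ge> 0" by (intro sum_nonneg) auto
  have "(M ^\<^sub>m Suc k) $$ (i, j) = (\<Sum>a<m. (M ^\<^sub>m k) $$ (i, a) * M $$ (a, j))"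
    using Suc.prems M by (simp add: scalar_prod_def lessThan_atLeast0)
  also have "cmod \<dots> \<le> (\<Sum>a<m. ?K ^ k * cmod (M $$ (a, j)))"
    using Suc.prems by (intro order_trans[OF norm_sum sum_mono])
      (auto simp: norm_mult intro!: mult_right_mono Suc.IH)
  also have "\<dots> = ?K ^ k * (\<Sum>a<m. cmod (M $$ (a, j)))" by (simp add: sum_distrib_left)
  also have "\<dots> \<le> ?K ^ k * ?K"
  proof (intro mult_left_mono sum_mono zero_le_power K)
    fix a
    show "cmod (M $$ (a, j)) \<le> (\<Sum>j<m. cmod (M $$ (a, j)))"
      using Suc.prems by (intro member_le_sum) auto
  qed
  finally show ?case by (simp add: mult.commute)
qed (use M in auto)

lemma pow_mat_smult:
  fixes M :: "'a::comm_ring_1 mat"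
  assumes M: "M \<in> carrier_mat m m"
  shows "(c \<cdot>\<^sub>m M) ^\<^sub>m k = c ^ k \<cdot>\<^sub>m (M ^\<^sub>m k)"
proof (induction k)
  case (Suc k)
  have "(c \<cdot>\<^sub>m M) ^\<^sub>m Suc k = (c ^ k \<cdot>\<^sub>m (M ^\<^sub>m k)) * (c \<cdot>\<^sub>m M)" by (simp add: Suc)
  also have "\<dots> = c ^ k \<cdot>\<^sub>m (c \<cdot>\<^sub>m (M ^\<^sub>m k * M))"
    using M mult_smult_assoc_mat[of "M ^\<^sub>m k" m m "c \<cdot>\<^sub>m M" m]
      mult_smult_distrib[of "M ^\<^sub>m k" m m M m c] by simp
  finally show ?case using M by (auto simp: mult_ac)
qed (use M in auto)

lemma mat_power_series_sums:
  assumes M: "M \<in> carrier_mat m m" and L: "L \<in> carrier_mat p m" and v: "v \<in> carrier_vec m"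
    and i: "i < p" and a: "\<And>k. cmod (a k) \<le> 1 / fact k"
  shows "(\<lambda>k. a k * s ^ k * (L *\<^sub>v ((M ^\<^sub>m k) *\<^sub>v v)) $ i)
    sums (L *\<^sub>v (mat_power_series a (s \<cdot>\<^sub>m M) *\<^sub>v v)) $ i"
proof -
  let ?T = "s \<cdot>\<^sub>m M"
  have T: "?T \<in> carrier_mat m m" using M by simp
  have expand: "(L *\<^sub>v (X *\<^sub>v v)) $ i = (\<Sum>r<m. \<Sum>j<m. L $$ (i, r) * (X $$ (r, j) * v $ j))"
    if X: "X \<in> carrier_mat m m" for X
    using X v mult_mat_vec_index_sum[OF L mult_mat_vec_carrier[OF X v] i]
    by (simp add: mult_mat_vec_index_sum[OF X v] sum_distrib_left del: index_mult_mat_vec)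
  have entry: "(\<lambda>k. a k * (?T ^\<^sub>m k) $$ (r, j)) sums (mat_power_series a ?T) $$ (r, j)"
    if rj: "r < m" "j < m" for r j
  proof -
    let ?K = "\<Sum>i<m. \<Sum>j<m. cmod (?T $$ (i, j))"
    have "summable (\<lambda>k. a k * (?T ^\<^sub>m k) $$ (r, j))"
    proof (rule summable_comparison_test')
      show "summable (\<lambda>k. 1 / fact k * ?K ^ k)"
        using summable_exp[of ?K] by (simp add: field_simps)
      show "norm (a k * (?T ^\<^sub>m k) $$ (r, j)) \<le> 1 / fact k * ?K ^ k" for k
        unfolding norm_mult by (intro mult_mono a pow_mat_entry_bound[OF T rj]) auto
    qed
    then show ?thesis using T M rj by (simp add: mat_power_series_def summable_sums)
  qed
  have "(\<lambda>k. \<Sum>r<m. \<Sum>j<m. L $$ (i, r) * (a k * (?T ^\<^sub>m k) $$ (r, j) * v $ j)) sums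
      (\<Sum>r<m. \<Sum>j<m. L $$ (i, r) * (mat_power_series a ?T $$ (r, j) * v $ j))"
    by (intro sums_sum sums_mult sums_mult2 entry) auto
  also have "(\<Sum>r<m. \<Sum>j<m. L $$ (i, r) * (mat_power_series a ?T $$ (r, j) * v $ j)) =
      (L *\<^sub>v (mat_power_series a ?T *\<^sub>v v)) $ i"
    using T by (intro expand[symmetric]) (auto simp: mat_power_series_def)
  also have "(\<lambda>k. \<Sum>r<m. \<Sum>j<m. L $$ (i, r) * (a k * (?T ^\<^sub>m k) $$ (r, j) * v $ j)) =
      (\<lambda>k. a k * s ^ k * (L *\<^sub>v ((M ^\<^sub>m k) *\<^sub>v v)) $ i)"
  proof
    fix k
    have Mk: "M ^\<^sub>m k \<in> carrier_mat m m" using M by simp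
    show "(\<Sum>r<m. \<Sum>j<m. L $$ (i, r) * (a k * (?T ^\<^sub>m k) $$ (r, j) * v $ j)) =
        a k * s ^ k * (L *\<^sub>v ((M ^\<^sub>m k) *\<^sub>v v)) $ i"
      unfolding expand[OF Mk] pow_mat_smult[OF M] sum_distrib_left
      using carrier_matD[OF Mk] by (intro sum.cong refl) (simp add: mult_ac)
  qed
  finally show ?thesis .
qed

lemma sums_tail_bound:
  fixes f :: "nat \<Rightarrow> complex"
  assumes f: "f sums s" and zero: "\<And>k. k < N \<Longrightarrow> f k = 0"
    and le: "\<And>k. N \<le> k \<Longrightarrow> cmod (f k) \<le> g k" and g: "summable g"
  shows "cmod s \<le> suminf g - (\<Sum>k<N. g k)"
proof -
  have gk: "summable (\<lambda>k. g (k + N))" using g by (rule summable_ignore_initial_segment)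
  have "(\<lambda>k. f (k + N)) sums s"
    using f zero by (subst sums_iff_shift) simp
  then have "cmod s = cmod (\<Sum>k. f (k + N))" by (simp add: sums_iff)
  also have "\<dots> \<le> (\<Sum>k. g (k + N))" using le by (intro norm_suminf_le gk) simp
  also have "\<dots> = suminf g - (\<Sum>k<N. g k)" by (rule suminf_minus_initial_segment[OF g])
  finally show ?thesis .
qed

section \<open>The Arnoldi process\<close>

definition arnoldi_vec :: "complex mat \<Rightarrow> complex vec \<Rightarrow> nat \<Rightarrow> complex vec" where
  "arnoldi_vec M b k = last (arnoldi M b (Suc k))"

lemma arnoldi_eq_map: "arnoldi M b N = map (arnoldi_vec M b) [0..<N]"
proof (induction N)
  case (Suc N)
  show ?case
  proof (cases N)
    case (Suc k)
    have "arnoldi M b (Suc N) = arnoldi M b N @ [arnoldi_vec M b N]"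
      by (simp add: Suc arnoldi_vec_def Let_def)
    then show ?thesis using Suc.IH by simp
  qed (simp add: arnoldi_vec_def)
qed simp

definition arnoldi_residual :: "complex mat \<Rightarrow> complex vec \<Rightarrow> nat \<Rightarrow> complex vec" where
  "arnoldi_residual M b k =
     orthogonalize (map (arnoldi_vec M b) [0..<Suc k]) (M *\<^sub>v arnoldi_vec M b k)"

lemma arnoldi_vec_0: "arnoldi_vec M b 0 = normalize_vec b"
  by (simp add: arnoldi_vec_def)

lemma arnoldi_vec_Suc: "arnoldi_vec M b (Suc k) = normalize_vec (arnoldi_residual M b k)"
  unfolding arnoldi_residual_def arnoldi_eq_map[symmetric] by (simp add: arnoldi_vec_def Let_def)

lemma arnoldi_residual_index:
  assumes "i < dim_row M"
  shows "arnoldi_residual M b k $ i = (M *\<^sub>v arnoldi_vec M b k) $ i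
    - (\<Sum>j<Suc k. ((M *\<^sub>v arnoldi_vec M b k) \<bullet>c arnoldi_vec M b j) * arnoldi_vec M b j $ i)"
  using assms unfolding arnoldi_residual_def orthogonalize_def
  by (simp add: o_def interv_sum_list_conv_sum_set_nat lessThan_atLeast0 del: upt_Suc index_mult_mat_vec sum.lessThan_Suc)

lemma arnoldi_residual_carrier [simp]:
  "M \<in> carrier_mat m m \<Longrightarrow> arnoldi_residual M b k \<in> carrier_vec m"
  by (intro carrier_vecI) (simp add: arnoldi_residual_def orthogonalize_def)

lemma arnoldi_vec_carrier [simp]:
  assumes "M \<in> carrier_mat m m" "b \<in> carrier_vec m"
  shows "arnoldi_vec M b k \<in> carrier_vec m"
  using assms by (cases k) (auto simp: arnoldi_vec_0 arnoldi_vec_Suc)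

lemma arnoldi_vec_unit:
  assumes "M \<in> carrier_mat m m" "b \<in> carrier_vec m" and ne: "arnoldi_vec M b k \<noteq> 0\<^sub>v m"
  shows "arnoldi_vec M b k \<bullet>c arnoldi_vec M b k = 1"
proof (cases k)
  case 0
  then show ?thesis using assms normalize_vec_unit[of b m]
    by (cases "b = 0\<^sub>v m") (auto simp: arnoldi_vec_0 normalize_vec_zero)
next
  case (Suc k')
  then show ?thesis using assms normalize_vec_unit[of "arnoldi_residual M b k'" m]
    by (cases "arnoldi_residual M b k' = 0\<^sub>v m") (auto simp: arnoldi_vec_Suc normalize_vec_zero)
qed

lemma arnoldi_vec_orthonormal:
  assumes M: "M \<in> carrier_mat m m" and b: "b \<in> carrier_vec m"
    and ne: "\<And>k. k < N \<Longrightarrow> arnoldi_vec M b k \<noteq> 0\<^sub>v m"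
    and "i < N" "j < N"
  shows "arnoldi_vec M b i \<bullet>c arnoldi_vec M b j = (if i = j then 1 else 0)"
proof -
  let ?q = "arnoldi_vec M b"
  note [simp] = M b
  have dq: "dim_vec (?q k) = m" for k using arnoldi_vec_carrier[OF M b, of k] by simp
  have sym: "?q j \<bullet>c ?q i = cnj (?q i \<bullet>c ?q j)" for i j
    by (simp add: cscalar_prod_eq_sum[OF dq] mult.commute)
  have "\<forall>i<k. ?q k \<bullet>c ?q i = 0" if "k < N" for k
    using that
  proof (induction k rule: less_induct)
    case (less k)
    show ?case
    proof (cases k)
      case (Suc k')
      let ?v = "M *\<^sub>v ?q k'" and ?r = "arnoldi_residual M b k'"
      have orth: "?q j \<bullet>c ?q i = (if i = j then 1 else 0)" if "i \<le> k'" "j \<le> k'" for i j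
        using less.IH[of i] less.IH[of j] less.prems that Suc arnoldi_vec_unit[OF M b ne, of i] sym[of i j]
        by (cases i j rule: linorder_cases) (auto simp: sym[of i j])
      have "?q k \<bullet>c ?q i = 0" if i: "i < k" for i
      proof -
        have "?r \<bullet>c ?q i = (\<Sum>a<m. (?v $ a - (\<Sum>j<Suc k'. (?v \<bullet>c ?q j) * ?q j $ a)) * cnj (?q i $ a))"
          by (subst cscalar_prod_eq_sum[OF dq])
            (intro sum.cong refl arg_cong2[of _ _ _ _ "(*)"] arnoldi_residual_index, use carrier_matD[OF M] in simp)
        also have "\<dots> = (?v \<bullet>c ?q i) - (\<Sum>a<m. \<Sum>j<Suc k'. (?v \<bullet>c ?q j) * (?q j $ a * cnj (?q i $ a)))"
          by (simp add: cscalar_prod_eq_sum[OF dq] left_diff_distrib sum_subtractf sum_distrib_right mult.assoc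
              del: index_mult_mat_vec sum.lessThan_Suc)
        also have "\<dots> = (?v \<bullet>c ?q i) - (\<Sum>j<Suc k'. (?v \<bullet>c ?q j) * (?q j \<bullet>c ?q i))"
          by (subst sum.swap) (simp add: cscalar_prod_eq_sum[OF dq] sum_distrib_left
              del: index_mult_mat_vec sum.lessThan_Suc)
        also have "(\<Sum>j<Suc k'. (?v \<bullet>c ?q j) * (?q j \<bullet>c ?q i)) =
            (\<Sum>j<Suc k'. if j = i then ?v \<bullet>c ?q i else 0)"
          using i Suc orth by (intro sum.cong) auto
        also have "\<dots> = ?v \<bullet>c ?q i" using i Suc by (simp add: sum.delta del: sum.lessThan_Suc)
        finally have r0: "?r \<bullet>c ?q i = 0" by simp
        have "?q k \<bullet>c ?q i = complex_of_real (1 / l2_norm ?r) * (?r \<bullet>c ?q i)"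
          unfolding Suc arnoldi_vec_Suc
          by (simp add: cscalar_prod_eq_sum[OF dq] normalize_vec_index carrier_vecD[OF arnoldi_residual_carrier[OF M]]
               sum_distrib_left mult.assoc)
        then show ?thesis using r0 by simp
      qed
      then show ?thesis by simp
    qed simp
  qed note lower = this
  show ?thesis
    using lower[of i] lower[of j] assms(4,5) arnoldi_vec_unit[OF M b ne, of i] sym[of i j]
    by (cases i j rule: linorder_cases) (auto simp: sym[of i j])
qed

text \<open>The vector \<open>M\<^sup>k b\<close> lies in the span of the first \<open>k + 1\<close> columns of \<open>Q\<close>, and \<open>M\<close> maps this span into that of the
  first \<open>k + 2\<close> columns. As long as \<open>k + 2 \<le> N\<close> the projection \<open>Q Q\<^sup>*\<close> is the identity there, so that
  \<open>F = Q\<^sup>* M Q\<close> acts on the coordinates as \<open>M\<close> acts on the vectors. The induction tracks the coordinate vector \<open>c\<close>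
  of \<open>M\<^sup>k b\<close> together with a bound on the position of its last nonzero entry.\<close>

lemma arnoldi_krylov:
  assumes M: "M \<in> carrier_mat m m" and b: "b \<in> carrier_vec m"
    and ne: "\<And>k. k < N \<Longrightarrow> arnoldi_vec M b k \<noteq> 0\<^sub>v m"
    and Q: "Q = mat_of_cols m (arnoldi M b N)" and F: "F = mat_adjoint Q * M * Q"
    and k: "k < N"
  shows "Q *\<^sub>v ((F ^\<^sub>m k) *\<^sub>v (complex_of_real (l2_norm b) \<cdot>\<^sub>v unit_vec N 0)) = (M ^\<^sub>m k) *\<^sub>v b"
proof -
  define q where "q = arnoldi_vec M b"
  have qc: "q j \<in> carrier_vec m" for j by (simp add: q_def M b)
  have Qc: "Q \<in> carrier_mat m N" unfolding Q arnoldi_eq_map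
    using mat_of_cols_carrier(1)[of m "map (arnoldi_vec M b) [0..<N]"] by simp
  have Q_index: "Q $$ (i, j) = q j $ i" if "i < m" "j < N" for i j
    using that by (simp add: Q arnoldi_eq_map mat_of_cols_index q_def)
  have Qac: "mat_adjoint Q \<in> carrier_mat N m"
    using Qc mat_of_rows_carrier(1)[of "m" "map conjugate (cols Q)"] by (simp add: mat_adjoint_def)
  have Fc: "F \<in> carrier_mat N N" unfolding F using Qac M Qc by simp
  have QQ: "mat_adjoint Q * Q = 1\<^sub>m N"
  proof (rule eq_matI)
    fix i j assume "i < dim_row (1\<^sub>m N)" "j < dim_col (1\<^sub>m N)"
    then have ij: "i < N" "j < N" by auto
    have cols: "col Q j = q j" if "j < N" for j
      using that Qc qc[of j] by (intro eq_vecI) (auto simp: Q_index)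
    have "row (mat_adjoint Q) i = conjugate (q i)"
      using ij Qc qc[of i] cols[of i] by (simp add: mat_adjoint_def)
    then have "(mat_adjoint Q * Q) $$ (i, j) = conjugate (q i) \<bullet> q j"
      using ij Qac Qc cols by simp
    also have "\<dots> = q j \<bullet>c q i"
      using qc[of i] qc[of j] by (intro comm_scalar_prod) auto
    finally show "(mat_adjoint Q * Q) $$ (i, j) = 1\<^sub>m N $$ (i, j)"
      using arnoldi_vec_orthonormal[OF M b ne, of N j i] ij by (simp add: q_def)
  qed (use Qac Qc in auto)
  \<comment> \<open>The Hessenberg coefficients of \<open>M q\<^sub>j\<close>; the subdiagonal one is the norm that normalization divides by.\<close>
  define h where "h = (\<lambda>j l. if l \<le> j then (M *\<^sub>v q j) \<bullet>c q l
    else if l = Suc j then complex_of_real (l2_norm (arnoldi_residual M b j)) else 0)"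
  have Mq: "(M *\<^sub>v q j) $ i = (\<Sum>l<N. h j l * q l $ i)" if j: "Suc j < N" and i: "i < m" for i j
  proof -
    have "(\<Sum>l<N. h j l * q l $ i) = (\<Sum>l<Suc (Suc j). h j l * q l $ i)"
      using j by (intro sum.mono_neutral_right) (auto simp: h_def)
    also have "\<dots> = (\<Sum>l<Suc j. ((M *\<^sub>v q j) \<bullet>c q l) * q l $ i)
        + complex_of_real (l2_norm (arnoldi_residual M b j)) * q (Suc j) $ i"
      unfolding sum.lessThan_Suc[of _ "Suc j"] by (intro arg_cong2[of _ _ _ _ "(+)"] sum.cong) (auto simp: h_def)
    also have "complex_of_real (l2_norm (arnoldi_residual M b j)) * q (Suc j) $ i = arnoldi_residual M b j $ i"
      using normalize_vec_scale[OF arnoldi_residual_carrier[OF M] i] ne[OF j] unfolding q_def arnoldi_vec_Suc by metis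
    also have "\<dots> = (M *\<^sub>v q j) $ i - (\<Sum>l<Suc j. ((M *\<^sub>v q j) \<bullet>c q l) * q l $ i)"
      using arnoldi_residual_index[of i M b j] i M by (simp add: q_def del: sum.lessThan_Suc)
    finally show ?thesis by (simp del: sum.lessThan_Suc index_mult_mat_vec)
  qed
  have Q_vec: "(Q *\<^sub>v c) $ i = (\<Sum>j<N. c $ j * q j $ i)" if "c \<in> carrier_vec N" "i < m" for c i
    using that Qc by (auto simp: scalar_prod_def lessThan_atLeast0 Q_index mult.commute intro!: sum.cong)
  have "\<exists>c \<in> carrier_vec N. (\<forall>j<N. k < j \<longrightarrow> c $ j = 0) \<and> (M ^\<^sub>m k) *\<^sub>v b = Q *\<^sub>v c \<and>
      (F ^\<^sub>m k) *\<^sub>v (complex_of_real (l2_norm b) \<cdot>\<^sub>v unit_vec N 0) = c"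
    using k
  proof (induction k)
    case 0
    have "b $ i = complex_of_real (l2_norm b) * q 0 $ i" if "i < m" for i
      using normalize_vec_scale[OF b that] ne[OF 0] by (simp add: q_def arnoldi_vec_0)
    then have "b = Q *\<^sub>v (complex_of_real (l2_norm b) \<cdot>\<^sub>v unit_vec N 0)"
      using b Qc 0 by (intro eq_vecI) (auto simp: Q_index)
    moreover have "(M ^\<^sub>m 0) *\<^sub>v b = b" using M b by simp
    ultimately show ?case
      using Fc by (intro bexI[of _ "complex_of_real (l2_norm b) \<cdot>\<^sub>v unit_vec N 0"]) auto
  next
    case (Suc k)
    then obtain c where c: "c \<in> carrier_vec N" "\<And>j. j < N \<Longrightarrow> k < j \<Longrightarrow> c $ j = 0"
      and Mk: "(M ^\<^sub>m k) *\<^sub>v b = Q *\<^sub>v c"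
      and Fk: "(F ^\<^sub>m k) *\<^sub>v (complex_of_real (l2_norm b) \<cdot>\<^sub>v unit_vec N 0) = c" by auto
    define c' where "c' = vec N (\<lambda>l. \<Sum>j<N. c $ j * h j l)"
    have c': "c' \<in> carrier_vec N" by (simp add: c'_def)
    have MQ: "M *\<^sub>v (Q *\<^sub>v c) = Q *\<^sub>v c'"
    proof (rule eq_vecI)
      fix i assume "i < dim_vec (Q *\<^sub>v c')"
      then have i: "i < m" using Qc by simp
      have "(M *\<^sub>v (Q *\<^sub>v c)) $ i = (\<Sum>a<m. M $$ (i, a) * (\<Sum>j<N. c $ j * q j $ a))"
        using i M Qc c by (auto simp: scalar_prod_def lessThan_atLeast0[of m] Q_vec simp del: index_mult_mat_vec(1) 
            intro!: sum.cong simp: index_mult_mat_vec[of i M])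
      also have "\<dots> = (\<Sum>j<N. c $ j * (\<Sum>a<m. M $$ (i, a) * q j $ a))"
        unfolding sum_distrib_left by (subst sum.swap) (simp add: mult.left_commute)
      also have "\<dots> = (\<Sum>j<N. c $ j * (M *\<^sub>v q j) $ i)"
        using i M carrier_vecD[OF qc] by (simp add: scalar_prod_def lessThan_atLeast0[of m])
      also have "\<dots> = (\<Sum>j<N. c $ j * (\<Sum>l<N. h j l * q l $ i))"
      proof (rule sum.cong[OF refl])
        fix j assume "j \<in> {..<N}"
        then show "c $ j * (M *\<^sub>v q j) $ i = c $ j * (\<Sum>l<N. h j l * q l $ i)"
          using Mq[of j i] c(2)[of j] Suc.prems i by (cases "k < j") auto
      qed
      also have "\<dots> = (\<Sum>l<N. c' $ l * q l $ i)"
        unfolding sum_distrib_left by (subst sum.swap) (simp add: c'_def sum_distrib_right mult.assoc)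
      also have "\<dots> = (Q *\<^sub>v c') $ i" using Q_vec[OF c' i] by simp
      finally show "(M *\<^sub>v (Q *\<^sub>v c)) $ i = (Q *\<^sub>v c') $ i" .
    qed (use M Qc in simp)
    have "F *\<^sub>v c = mat_adjoint Q *\<^sub>v (M *\<^sub>v (Q *\<^sub>v c))"
      unfolding F using assoc_mult_mat_vec[OF mult_carrier_mat[OF Qac M] Qc c(1)]
        assoc_mult_mat_vec[OF Qac M mult_mat_vec_carrier[OF Qc c(1)]] by simp
    also have "\<dots> = c'"
      unfolding MQ using assoc_mult_mat_vec[OF Qac Qc c'] QQ c' by simp
    finally have Fc': "F *\<^sub>v c = c'" .
    have "c' $ l = 0" if "l < N" "Suc k < l" for l
    proof -
      have "c $ j * h j l = 0" if "j < N" for j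
        using c(2)[OF that] \<open>Suc k < l\<close> by (cases "k < j") (auto simp: h_def)
      then show ?thesis using \<open>l < N\<close> by (simp add: c'_def sum.neutral)
    qed
    then show ?case
      using c' MQ Fc' Fk Mk
      by (intro bexI[of _ c']) (auto simp: pow_mat_Suc_vec[OF M b] pow_mat_Suc_vec[OF Fc] simp del: pow_mat.simps)
  qed
  then show ?thesis by auto
qed

text \<open>No breakdown: with lower left block zero and lower right block Hessenberg with nonzero subdiagonal, each
  Arnoldi step makes one further entry of the lower block nonzero, which orthogonalization against the earlier vectors cannot
  cancel because they vanish there.\<close>

lemma arnoldi_vec_hessenberg_nonzero:
  assumes M: "M \<in> carrier_mat (n + N) (n + N)" and b: "b \<in> carrier_vec (n + N)"
    and b0: "b $ n \<noteq> 0" and bz: "\<And>i. 0 < i \<Longrightarrow> i < N \<Longrightarrow> b $ (n + i) = 0"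
    and left: "\<And>i a. i < N \<Longrightarrow> a < n \<Longrightarrow> M $$ (n + i, a) = 0"
    and hess: "\<And>i j. i < N \<Longrightarrow> Suc j < i \<Longrightarrow> M $$ (n + i, n + j) = 0"
    and sub: "\<And>j. Suc j < N \<Longrightarrow> M $$ (n + Suc j, n + j) \<noteq> 0"
    and k: "k < N"
  shows "arnoldi_vec M b k $ (n + k) \<noteq> 0 \<and> (\<forall>i<N. k < i \<longrightarrow> arnoldi_vec M b k $ (n + i) = 0)"
  using k
proof (induction k rule: less_induct)
  case (less k)
  let ?q = "arnoldi_vec M b"
  have dq: "dim_vec (?q j) = n + N" for j using arnoldi_vec_carrier[OF M b, of j] by simp
  have normalize: "normalize_vec v $ i \<noteq> 0" if "v \<in> carrier_vec (n + N)" "i < n + N" "v $ i \<noteq> 0" for v i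
    using that l2_norm_eq_0_iff[of v "n + N"] by (auto simp: normalize_vec_index)
  show ?case
  proof (cases k)
    case 0
    then show ?thesis
      using normalize[OF b _ b0] bz b less.prems by (auto simp: arnoldi_vec_0 normalize_vec_index)
  next
    case (Suc k')
    have IH: "?q j $ (n + i) = 0" if "j \<le> k'" "j < i" "i < N" for i j
      using less.IH[of j] that less.prems Suc by auto
    have Mq: "(M *\<^sub>v ?q k') $ (n + i) = M $$ (n + i, n + k') * ?q k' $ (n + k')"
      if i: "k' < i" "i < N" for i
    proof -
      have "(M *\<^sub>v ?q k') $ (n + i) = (\<Sum>a<n + N. M $$ (n + i, a) * ?q k' $ a)"
        using i M dq[of k'] by (auto simp: scalar_prod_def lessThan_atLeast0 intro!: sum.cong)
      also have "\<dots> = (\<Sum>a\<in>{n + k'}. M $$ (n + i, a) * ?q k' $ a)"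
      proof (rule sum.mono_neutral_right)
        show "\<forall>a\<in>{..<n + N} - {n + k'}. M $$ (n + i, a) * ?q k' $ a = 0"
        proof
          fix a assume a: "a \<in> {..<n + N} - {n + k'}"
          consider "a < n" | j where "a = n + j" "j < k'" | j where "a = n + j" "k' < j" "j < N"
            using a by (metis DiffE add_less_cancel_left insertI1 le_iff_add lessThan_iff linorder_neqE_nat not_less)
          then show "M $$ (n + i, a) * ?q k' $ a = 0"
          proof cases
            case 1 then show ?thesis using left i by simp
          next
            case 2 then show ?thesis using hess i by simp
          next
            case 3 then show ?thesis using IH by simp
          qed
        qed
      qed (use less.prems Suc in auto)
      finally show ?thesis by simp
    qed
    have res: "arnoldi_residual M b k' $ (n + i) = M $$ (n + i, n + k') * ?q k' $ (n + k')"
      if i: "k' < i" "i < N" for i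
    proof -
      have "(\<Sum>j<Suc k'. ((M *\<^sub>v ?q k') \<bullet>c ?q j) * ?q j $ (n + i)) = 0"
        using IH i by (intro sum.neutral) auto
      then show ?thesis
        using arnoldi_residual_index[of "n + i" M b k'] Mq[OF i] i M by simp
    qed
    have rc: "arnoldi_residual M b k' \<in> carrier_vec (n + N)" using M by simp
    have "arnoldi_residual M b k' $ (n + k) \<noteq> 0"
      using res[of k] Suc less.prems less.IH[of k'] sub[of k'] by simp
    then have "?q k $ (n + k) \<noteq> 0"
      using normalize[OF rc] less.prems by (simp add: Suc arnoldi_vec_Suc)
    moreover have "?q k $ (n + i) = 0" if "i < N" "k < i" for i
      using res[of i] that Suc hess[of i k'] carrier_vecD[OF rc]
      by (simp add: arnoldi_vec_Suc normalize_vec_index)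
    ultimately show ?thesis by blast
  qed
qed

section \<open>The basis matrices\<close>

lemma basis_mat_dims [simp]: "dim_row (basis_mat kind N) = N" "dim_col (basis_mat kind N) = N"
  by (cases kind; simp)+

lemma basis_mat_index:
  "i < N \<Longrightarrow> j < N \<Longrightarrow> basis_mat kind N $$ (i, j) =
    (if i = Suc j then sub_coeff kind else if j = Suc i then super_coeff kind i else 0)"
  by (cases kind) auto

abbreviation cbasis_mat :: "basis_kind \<Rightarrow> nat \<Rightarrow> complex mat" where
  "cbasis_mat kind N \<equiv> map_mat complex_of_real (basis_mat kind N)"

lemma basis_row_sum:
  fixes x :: "nat \<Rightarrow> 'a::real_normed_field"
  assumes "l < N"
  shows "(\<Sum>j<N. (if l = Suc j then x j else if j = Suc l then y j else 0)) =
    (if l = 0 then 0 else x (l - 1)) + (if Suc l < N then y (Suc l) else 0)"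
proof -
  have "(\<Sum>j<N. (if l = Suc j then x j else if j = Suc l then y j else 0)) =
      (\<Sum>j<N. (if l = Suc j then x j else 0)) + (\<Sum>j<N. (if j = Suc l then y j else 0))"
    unfolding sum.distrib[symmetric] by (intro sum.cong) auto
  also have "(\<Sum>j<N. (if l = Suc j then x j else 0)) = (if l = 0 then 0 else x (l - 1))"
  proof (cases l)
    case (Suc l')
    then have "(\<Sum>j<N. (if l = Suc j then x j else 0)) = (\<Sum>j<N. (if j = l' then x j else 0))"
      by (intro sum.cong) auto
    then show ?thesis using Suc assms by simp
  qed simp
  finally show ?thesis by simp
qed

text \<open>Truncating \<open>H\<close> to size \<open>N\<close> is harmless for \<open>k < N\<close>: the first entry that is cut off, \<open>taylor kind k N\<close>, is
  still zero.\<close>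

lemma cbasis_mat_krylov:
  assumes "k < N" "l < N"
  shows "((cbasis_mat kind N ^\<^sub>m k) *\<^sub>v unit_vec N 0) $ l = of_real (taylor kind k l)"
  using assms
proof (induction k arbitrary: l)
  case 0
  have "(cbasis_mat kind N ^\<^sub>m 0) *\<^sub>v unit_vec N 0 = (unit_vec N 0 :: complex vec)"
    using one_mult_mat_vec[of "unit_vec N 0 :: complex vec" N] by simp
  with 0 show ?case by simp
next
  case (Suc k)
  let ?H = "cbasis_mat kind N"
  have H: "?H \<in> carrier_mat N N" by auto
  define v where "v = (?H ^\<^sub>m k) *\<^sub>v unit_vec N 0"
  have v: "v \<in> carrier_vec N"
    unfolding v_def by (intro mult_mat_vec_carrier[OF pow_carrier_mat[OF H]] unit_vec_carrier)
  have vl: "v $ l = of_real (taylor kind k l)" if "l < N" for l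
    using Suc.IH[of l] Suc.prems that by (simp add: v_def)
  have "((?H ^\<^sub>m Suc k) *\<^sub>v unit_vec N 0) $ l = (?H *\<^sub>v v) $ l"
    using pow_mat_Suc_vec[OF H unit_vec_carrier, of k 0] by (simp only: v_def)
  also have "\<dots> = (\<Sum>j<N. ?H $$ (l, j) * v $ j)"
    by (rule mult_mat_vec_index_sum[OF H v Suc.prems(2)])
  also have "\<dots> = (\<Sum>j<N. if l = Suc j then of_real (sub_coeff kind) * of_real (taylor kind k j)
        else if j = Suc l then of_real (super_coeff kind l) * of_real (taylor kind k j) else 0)"
    using Suc.prems by (intro sum.cong) (auto simp: basis_mat_index vl)
  also have "\<dots> = complex_of_real (taylor kind (Suc k) l)"
    using Suc.prems taylor_upper_zero[of k "Suc l" kind]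
    by (subst basis_row_sum) auto
  finally show ?case .
qed

lemma cbasis_mat_eigenvalue:
  assumes "eigenvalue (cbasis_mat kind N) e"
  shows "cmod e \<le> 1"
proof (rule eigenvalue_le_row_sum[OF _ assms])
  fix i assume i: "i < N"
  have "(\<Sum>j<N. cmod (cbasis_mat kind N $$ (i, j))) =
      (\<Sum>j<N. if i = Suc j then \<bar>sub_coeff kind\<bar> else if j = Suc i then \<bar>super_coeff kind i\<bar> else 0)"
    using i by (intro sum.cong) (auto simp: basis_mat_index)
  also have "\<dots> \<le> 1"
    using i coeff_row_sum[of i kind] by (subst basis_row_sum) (auto split: if_splits)
  finally show "(\<Sum>j<N. cmod (cbasis_mat kind N $$ (i, j))) \<le> 1" .
qed auto

lemma coeff_mat_carrier [simp]: "coeff_mat n w N \<in> carrier_mat n N"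
  using mat_of_cols_carrier(1)[of n "map w [0..<N]"] by (simp add: coeff_mat_def)

lemma coeff_mat_krylov:
  assumes "k < N" "i < n"
  shows "(coeff_mat n w N *\<^sub>v ((cbasis_mat kind N ^\<^sub>m k) *\<^sub>v unit_vec N 0)) $ i =
    (\<Sum>l\<le>k. w l $ i * of_real (taylor kind k l))"
proof -
  let ?v = "(cbasis_mat kind N ^\<^sub>m k) *\<^sub>v unit_vec N 0"
  have v: "?v \<in> carrier_vec N" by (intro carrier_vecI) simp
  have "(coeff_mat n w N *\<^sub>v ?v) $ i = (\<Sum>l<N. coeff_mat n w N $$ (i, l) * ?v $ l)"
    by (rule mult_mat_vec_index_sum[OF coeff_mat_carrier v assms(2)])
  also have "\<dots> = (\<Sum>l<N. w l $ i * of_real (taylor kind k l))"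
    using assms cbasis_mat_krylov[of k N _ kind]
    by (intro sum.cong) (auto simp: coeff_mat_def mat_of_cols_index simp del: index_mult_mat_vec)
  also have "\<dots> = (\<Sum>l\<le>k. w l $ i * of_real (taylor kind k l))"
    using assms taylor_upper_zero[of k _ kind] by (intro sum.mono_neutral_right) auto
  finally show ?thesis .
qed

section \<open>Krylov vectors of the augmented matrix\<close>

lemma augmented_mat_carrier:
  "A \<in> carrier_mat n n \<Longrightarrow> augmented_mat kind A w N \<in> carrier_mat (n + N) (n + N)"
  unfolding augmented_mat_def by (intro four_block_carrier_mat) auto

lemma start_vec_carrier: "u0 \<in> carrier_vec n \<Longrightarrow> start_vec u0 N \<in> carrier_vec (n + N)"
  by (simp add: start_vec_def)

primrec top_krylov ::
  "basis_kind \<Rightarrow> complex mat \<Rightarrow> complex vec \<Rightarrow> (nat \<Rightarrow> complex vec) \<Rightarrow> nat \<Rightarrow> nat \<Rightarrow> complex vec" where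
  "top_krylov kind A u0 w N 0 = u0"
| "top_krylov kind A u0 w N (Suc k) = A *\<^sub>v top_krylov kind A u0 w N k
     + coeff_mat (dim_row A) w N *\<^sub>v ((cbasis_mat kind N ^\<^sub>m k) *\<^sub>v unit_vec N 0)"

lemma top_krylov_carrier:
  assumes "A \<in> carrier_mat n n" "u0 \<in> carrier_vec n"
  shows "top_krylov kind A u0 w N k \<in> carrier_vec n"
proof (induction k)
  case (Suc k)
  have "(cbasis_mat kind N ^\<^sub>m k) *\<^sub>v unit_vec N 0 \<in> carrier_vec N"
    by (intro carrier_vecI) simp
  then show ?case
    using assms Suc mult_mat_vec_carrier[OF coeff_mat_carrier] by (auto intro!: add_carrier_vec)
qed (use assms in simp)

lemma augmented_mat_krylov:
  assumes A: "A \<in> carrier_mat n n" and u0: "u0 \<in> carrier_vec n"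
  shows "(augmented_mat kind A w N ^\<^sub>m k) *\<^sub>v start_vec u0 N =
    top_krylov kind A u0 w N k @\<^sub>v ((cbasis_mat kind N ^\<^sub>m k) *\<^sub>v unit_vec N 0)"
proof (induction k)
  case 0
  have "(augmented_mat kind A w N ^\<^sub>m 0) *\<^sub>v start_vec u0 N = start_vec u0 N"
    using augmented_mat_carrier[OF A, of kind w N] start_vec_carrier[OF u0, of N] by simp
  moreover have "(cbasis_mat kind N ^\<^sub>m 0) *\<^sub>v unit_vec N 0 = (unit_vec N 0 :: complex vec)"
    using one_mult_mat_vec[of "unit_vec N 0 :: complex vec" N] by simp
  ultimately show ?case by (simp add: start_vec_def del: pow_mat.simps)
next
  case (Suc k)
  let ?H = "cbasis_mat kind N"
  have H: "?H \<in> carrier_mat N N" by auto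
  have v: "(?H ^\<^sub>m k) *\<^sub>v unit_vec N 0 \<in> carrier_vec N"
    by (intro mult_mat_vec_carrier[OF pow_carrier_mat[OF H]] unit_vec_carrier)
  have x: "top_krylov kind A u0 w N k \<in> carrier_vec n" by (rule top_krylov_carrier[OF A u0])
  have "(augmented_mat kind A w N ^\<^sub>m Suc k) *\<^sub>v start_vec u0 N =
      augmented_mat kind A w N *\<^sub>v (top_krylov kind A u0 w N k @\<^sub>v ((?H ^\<^sub>m k) *\<^sub>v unit_vec N 0))"
    using pow_mat_Suc_vec[OF augmented_mat_carrier[OF A, of kind w N] start_vec_carrier[OF u0, of N], of k] Suc by simp
  also have "\<dots> = (A *\<^sub>v top_krylov kind A u0 w N k + coeff_mat n w N *\<^sub>v ((?H ^\<^sub>m k) *\<^sub>v unit_vec N 0))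
      @\<^sub>v (0\<^sub>m N n *\<^sub>v top_krylov kind A u0 w N k + ?H *\<^sub>v ((?H ^\<^sub>m k) *\<^sub>v unit_vec N 0))"
    unfolding augmented_mat_def using A H x v
    by (subst four_block_mat_mult_vec[of A n n _ N _ N]) auto
  also have "0\<^sub>m N n *\<^sub>v top_krylov kind A u0 w N k + ?H *\<^sub>v ((?H ^\<^sub>m k) *\<^sub>v unit_vec N 0) =
      (?H ^\<^sub>m Suc k) *\<^sub>v unit_vec N 0"
  proof -
    have "0\<^sub>m N n *\<^sub>v top_krylov kind A u0 w N k = 0\<^sub>v N" using x by auto
    moreover have "?H *\<^sub>v ((?H ^\<^sub>m k) *\<^sub>v unit_vec N 0) \<in> carrier_vec N"
      by (rule mult_mat_vec_carrier[OF H v])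
    ultimately show ?thesis
      using pow_mat_Suc_vec[OF H unit_vec_carrier, of k 0] by (simp only: left_zero_vec)
  qed
  finally show ?case using A by simp
qed

text \<open>The essential point is that the right-hand side does not contain \<open>N\<close>. The assumption bounds \<open>W\<^sub>N H\<^sub>N\<^sup>k e\<^sub>1\<close>
  only for \<open>k < N\<close>, by \<open>c S\<^sup>k\<close>. For \<open>k \<ge> N\<close> the Krylov bound with eigenvalues of modulus at most \<open>1\<close> gives
  \<open>c S\<^sup>N 2\<^sup>N\<^sup>+\<^sup>k\<close>, which is at most \<open>c (4 S)\<^sup>k\<close>.\<close>

lemma top_krylov_bound:
  assumes A: "A \<in> carrier_mat n n" and u0: "u0 \<in> carrier_vec n"
    and c: "c \<ge> 0" and S: "S \<ge> 1"
    and small: "\<And>k i. i < n \<Longrightarrow> cmod (\<Sum>l\<le>k. w l $ i * of_real (taylor kind k l)) \<le> c * S ^ k"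
    and i: "i < n"
  shows "cmod (top_krylov kind A u0 w N k $ i) \<le>
    ((\<Sum>i<n. cmod (u0 $ i)) + c) * ((\<Sum>i<n. \<Sum>j<n. cmod (A $$ (i, j))) + 4 * S) ^ k"
  using i
proof (induction k arbitrary: i)
  case 0
  have "cmod (u0 $ i) \<le> (\<Sum>i<n. cmod (u0 $ i))" using 0 by (intro member_le_sum) auto
  then show ?case using c by simp
next
  case (Suc k)
  let ?H = "cbasis_mat kind N" and ?W = "coeff_mat n w N"
  have H: "?H \<in> carrier_mat N N" by auto
  define a where "a = (\<Sum>i<n. \<Sum>j<n. cmod (A $$ (i, j)))"
  define D where "D = (\<Sum>i<n. cmod (u0 $ i)) + c"
  have pos: "a \<ge> 0" "D \<ge> c" "D \<ge> 0" using c by (auto simp: a_def D_def intro!: sum_nonneg add_nonneg_nonneg)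
  let ?x = "top_krylov kind A u0 w N k"
  let ?y = "?W *\<^sub>v ((?H ^\<^sub>m k) *\<^sub>v unit_vec N 0)"
  have xc: "?x \<in> carrier_vec n" by (rule top_krylov_carrier[OF A u0])
  have start: "cmod ((?W *\<^sub>v ((?H ^\<^sub>m k) *\<^sub>v unit_vec N 0)) $ i) \<le> c * S ^ N" if "k < N" for k
  proof -
    have "cmod ((?W *\<^sub>v ((?H ^\<^sub>m k) *\<^sub>v unit_vec N 0)) $ i) \<le> c * S ^ k"
      using small[OF Suc.prems, of k] unfolding coeff_mat_krylov[OF that Suc.prems] .
    also have "\<dots> \<le> c * S ^ N" using c S that by (intro mult_left_mono power_increasing) auto
    finally show ?thesis .
  qed
  have y: "cmod (?y $ i) \<le> c * (4 * S) ^ k"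
  proof (cases "k < N")
    case True
    have "cmod (?y $ i) \<le> c * S ^ k"
      using small[OF Suc.prems, of k] unfolding coeff_mat_krylov[OF True Suc.prems] .
    also have "\<dots> \<le> c * (4 * S) ^ k" using c S by (intro mult_left_mono power_mono) auto
    finally show ?thesis .
  next
    case False
    have "cmod (?y $ i) \<le> c * S ^ N * (1 + 1) ^ (N + k)"
      using krylov_bound[OF H coeff_mat_carrier unit_vec_carrier Suc.prems cbasis_mat_eigenvalue, where B = "c * S ^ N" and l = k]
        start c S by simp
    also have "\<dots> \<le> c * S ^ k * (1 + 1) ^ (k + k)"
      using c S False by (intro mult_mono mult_left_mono power_increasing) auto
    also have "\<dots> = c * (4 * S) ^ k"
      by (simp add: power_mult_distrib power_add flip: mult.assoc) (simp add: power_mult_distrib[symmetric])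
    finally show ?thesis .
  qed
  have "cmod ((A *\<^sub>v ?x) $ i) \<le> (\<Sum>j<n. cmod (A $$ (i, j)) * (D * (a + 4 * S) ^ k))"
    unfolding mult_mat_vec_index_sum[OF A xc Suc.prems]
    using Suc.IH by (intro order_trans[OF norm_sum sum_mono])
      (auto simp: norm_mult a_def D_def intro!: mult_left_mono)
  also have "\<dots> = (\<Sum>j<n. cmod (A $$ (i, j))) * (D * (a + 4 * S) ^ k)"
    by (simp add: sum_distrib_right)
  also have "\<dots> \<le> a * (D * (a + 4 * S) ^ k)"
  proof (rule mult_right_mono)
    show "(\<Sum>j<n. cmod (A $$ (i, j))) \<le> a"
      unfolding a_def using Suc.prems
      by (intro member_le_sum[of i "{..<n}" "\<lambda>i. \<Sum>j<n. cmod (A $$ (i, j))"]) (auto intro: sum_nonneg)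
    show "0 \<le> D * (a + 4 * S) ^ k" using pos S by simp
  qed
  finally have Ax: "cmod ((A *\<^sub>v ?x) $ i) \<le> a * (D * (a + 4 * S) ^ k)" .
  have "c * (4 * S) ^ k \<le> D * (a + 4 * S) ^ k"
    using pos c S by (intro mult_mono power_mono) auto
  also have "\<dots> \<le> 4 * S * (D * (a + 4 * S) ^ k)"
    using pos S mult_right_mono[of 1 "4 * S" "D * (a + 4 * S) ^ k"] by simp
  finally have y': "cmod (?y $ i) \<le> 4 * S * (D * (a + 4 * S) ^ k)" using y by linarith
  have "top_krylov kind A u0 w N (Suc k) $ i = (A *\<^sub>v ?x) $ i + ?y $ i"
    using A carrier_matD[OF coeff_mat_carrier[of n w N]] Suc.prems by (simp del: index_mult_mat_vec(1))
  then have "cmod (top_krylov kind A u0 w N (Suc k) $ i) \<le> cmod ((A *\<^sub>v ?x) $ i) + cmod (?y $ i)"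
    by (metis norm_triangle_ineq)
  also have "\<dots> \<le> D * (a + 4 * S) ^ Suc k" using Ax y' by (simp add: algebra_simps)
  finally show ?case by (simp only: a_def D_def)
qed

lemma top_selector_carrier: "top_selector n N \<in> carrier_mat n (n + N)"
  unfolding top_selector_def
  using four_block_carrier_mat[of "1\<^sub>m n" n n "0\<^sub>m 0 N" 0 N "0\<^sub>m n N" "0\<^sub>m 0 n"] by simp

lemma top_selector_index:
  assumes "x \<in> carrier_vec n" "y \<in> carrier_vec N" "i < n"
  shows "(top_selector n N *\<^sub>v (x @\<^sub>v y)) $ i = x $ i"
proof -
  have "top_selector n N *\<^sub>v (x @\<^sub>v y) = (1\<^sub>m n *\<^sub>v x + 0\<^sub>m n N *\<^sub>v y) @\<^sub>v (0\<^sub>m 0 n *\<^sub>v x + 0\<^sub>m 0 N *\<^sub>v y)"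
    unfolding top_selector_def using assms by (intro four_block_mat_mult_vec) auto
  then show ?thesis using assms by simp
qed

section \<open>The Arnoldi approximation\<close>

lemma arnoldi_Q_carrier:
  "A \<in> carrier_mat n n \<Longrightarrow> arnoldi_Q kind A u0 w N \<in> carrier_mat (n + N) N"
  using mat_of_cols_carrier(1)[of "n + N" "arnoldi (augmented_mat kind A w N) (start_vec u0 N) N"]
  by (simp add: arnoldi_Q_def arnoldi_eq_map)

lemma arnoldi_F_carrier:
  assumes A: "A \<in> carrier_mat n n"
  shows "arnoldi_F kind A u0 w N \<in> carrier_mat N N"
proof -
  note Q = arnoldi_Q_carrier[OF A, of kind u0 w N]
  have "mat_adjoint (arnoldi_Q kind A u0 w N) \<in> carrier_mat N (n + N)"
    using Q mat_of_rows_carrier(1)[of "n + N" "map conjugate (cols (arnoldi_Q kind A u0 w N))"]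
    by (simp add: mat_adjoint_def)
  then show ?thesis
    unfolding arnoldi_F_def using Q augmented_mat_carrier[OF A, of kind w N] by (intro mult_carrier_mat)
qed

lemma arnoldi_Q1_mult:
  assumes A: "A \<in> carrier_mat n n" and v: "v \<in> carrier_vec N" and i: "i < n"
  shows "(arnoldi_Q1 kind A u0 w N *\<^sub>v v) $ i = (arnoldi_Q kind A u0 w N *\<^sub>v v) $ i"
proof -
  have Q1: "arnoldi_Q1 kind A u0 w N \<in> carrier_mat n N" using A by (simp add: arnoldi_Q1_def)
  show ?thesis
    unfolding mult_mat_vec_index_sum[OF Q1 v i]
    using mult_mat_vec_index_sum[OF arnoldi_Q_carrier[OF A] v, of i kind u0 w] i A
    by (simp add: arnoldi_Q1_def)
qed

lemma augmented_arnoldi_vec_nonzero: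
  assumes A: "A \<in> carrier_mat n n" and u0: "u0 \<in> carrier_vec n" and k: "k < N"
  shows "arnoldi_vec (augmented_mat kind A w N) (start_vec u0 N) k \<noteq> 0\<^sub>v (n + N)"
proof -
  let ?M = "augmented_mat kind A w N" and ?b = "start_vec u0 N"
  have sub_nonzero: "sub_coeff kind \<noteq> 0" by (cases kind) auto
  have low: "?M $$ (n + i, a) = 0" if "i < N" "a < n" for i a
    using that A carrier_matD[OF coeff_mat_carrier[of n w N]] by (simp add: augmented_mat_def)
  have low': "?M $$ (n + i, n + j) = complex_of_real (basis_mat kind N $$ (i, j))" if "i < N" "j < N" for i j
    using that A carrier_matD[OF coeff_mat_carrier[of n w N]] by (simp add: augmented_mat_def)
  have "arnoldi_vec ?M ?b k $ (n + k) \<noteq> 0 \<and> (\<forall>i<N. k < i \<longrightarrow> arnoldi_vec ?M ?b k $ (n + i) = 0)"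
  proof (rule arnoldi_vec_hessenberg_nonzero[OF augmented_mat_carrier[OF A] start_vec_carrier[OF u0] _ _ low _ _ k])
    show "?b $ n \<noteq> 0" "\<And>i. 0 < i \<Longrightarrow> i < N \<Longrightarrow> ?b $ (n + i) = 0"
      using u0 k by (auto simp: start_vec_def)
    show "\<And>i j. i < N \<Longrightarrow> Suc j < i \<Longrightarrow> ?M $$ (n + i, n + j) = 0"
      by (subst low') (auto simp: basis_mat_index)
    show "\<And>j. Suc j < N \<Longrightarrow> ?M $$ (n + Suc j, n + j) \<noteq> 0"
      using sub_nonzero by (subst low') (auto simp: basis_mat_index)
  qed
  then show ?thesis using k by auto
qed

lemma arnoldi_matches_krylov:
  assumes A: "A \<in> carrier_mat n n" and u0: "u0 \<in> carrier_vec n" and k: "k < N" and i: "i < n"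
  shows "arnoldi_beta u0 N * (arnoldi_Q1 kind A u0 w N *\<^sub>v
      ((arnoldi_F kind A u0 w N ^\<^sub>m k) *\<^sub>v unit_vec N 0)) $ i = top_krylov kind A u0 w N k $ i"
proof -
  let ?F = "arnoldi_F kind A u0 w N" and ?Q = "arnoldi_Q kind A u0 w N" and ?\<beta> = "arnoldi_beta u0 N"
  let ?M = "augmented_mat kind A w N" and ?b = "start_vec u0 N"
  note Q = arnoldi_Q_carrier[OF A, of kind u0 w N] and F = arnoldi_F_carrier[OF A, of kind u0 w N]
  note Fk = pow_carrier_mat[OF F, of k]
  have e: "(?F ^\<^sub>m k) *\<^sub>v unit_vec N 0 \<in> carrier_vec N"
    by (rule mult_mat_vec_carrier[OF Fk unit_vec_carrier])
  have "?\<beta> * (arnoldi_Q1 kind A u0 w N *\<^sub>v ((?F ^\<^sub>m k) *\<^sub>v unit_vec N 0)) $ i =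
      (?\<beta> \<cdot>\<^sub>v (?Q *\<^sub>v ((?F ^\<^sub>m k) *\<^sub>v unit_vec N 0))) $ i"
    unfolding arnoldi_Q1_mult[OF A e i] using Q i by (simp del: index_mult_mat_vec(1))
  also have "\<dots> = (?Q *\<^sub>v ((?F ^\<^sub>m k) *\<^sub>v (?\<beta> \<cdot>\<^sub>v unit_vec N 0))) $ i"
    by (simp only: mult_mat_vec[OF Fk unit_vec_carrier] mult_mat_vec[OF Q e])
  also have "\<dots> = ((?M ^\<^sub>m k) *\<^sub>v ?b) $ i"
    unfolding arnoldi_beta_def
    using A by (subst arnoldi_krylov[OF augmented_mat_carrier[OF A] start_vec_carrier[OF u0]
      augmented_arnoldi_vec_nonzero[OF A u0] _ _ k]) (auto simp: arnoldi_Q_def arnoldi_F_def)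
  also have "\<dots> = top_krylov kind A u0 w N k $ i"
    unfolding augmented_mat_krylov[OF A u0] using top_krylov_carrier[OF A u0, of kind w N k] i
    by simp
  finally show ?thesis .
qed

theorem theorem15:
  fixes kind :: basis_kind
    and n :: nat
    and A :: "complex mat"
    and u0 :: "complex vec"
    and g :: "complex \<Rightarrow> complex vec"
    and w :: "nat \<Rightarrow> complex vec"
    and t :: real
  assumes "A \<in> carrier_mat n n"
    and "u0 \<in> carrier_vec n"
    and "\<And>s. g s \<in> carrier_vec n"
    and "\<And>l. w l \<in> carrier_vec n"
    and "\<And>i. i < n \<Longrightarrow> (\<lambda>s. g s $ i) holomorphic_on UNIV"
    and "\<And>s i. i < n \<Longrightarrow> (\<lambda>l. w l $ i * basis_fun kind l s) sums (g s $ i)"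
    and "\<exists>c>0. \<forall>l. l2_norm (deriv_vec_at_0 n g l) \<le> c * spectral_norm A ^ l"
    and "\<exists>C. \<forall>N>0. spectral_norm (arnoldi_F kind A u0 w N ^\<^sub>m N) \<le> C ^ N"
    and "t \<ge> 0"
  shows "(\<lambda>N. l2_norm (arnoldi_tail kind A u0 w N t)) \<longlonglongrightarrow> 0 \<and>
    (\<lambda>N. l2_norm (truncated_sol kind A u0 w N t - arnoldi_sol kind A u0 w N t)) \<longlonglongrightarrow> 0"
proof -
  note A = assms(1) and u0 = assms(2) and t = assms(9)
  obtain c where c: "c > 0"
    and deriv_le: "\<And>l. l2_norm (deriv_vec_at_0 n g l) \<le> c * spectral_norm A ^ l"
    using assms(7) by blast
  obtain C where F_le: "\<And>N. N > 0 \<Longrightarrow> spectral_norm (arnoldi_F kind A u0 w N ^\<^sub>m N) \<le> C ^ N"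
    using assms(8) by blast
  define S where "S = max 1 \<bar>spectral_norm A\<bar>"
  have S: "S \<ge> 1" by (simp add: S_def)
  have small: "cmod (\<Sum>l\<le>k. w l $ i * of_real (taylor kind k l)) \<le> c * S ^ k" if i: "i < n" for k i
  proof -
    have "(\<Sum>l\<le>k. w l $ i * of_real (taylor kind k l)) = deriv_vec_at_0 n g k $ i"
      using higher_deriv_basis_expansion[OF assms(6)[OF i], of k] i by (simp add: deriv_vec_at_0_def)
    then have "cmod (\<Sum>l\<le>k. w l $ i * of_real (taylor kind k l)) \<le> l2_norm (deriv_vec_at_0 n g k)"
      using cmod_le_l2_norm[of i "deriv_vec_at_0 n g k"] i by (simp add: deriv_vec_at_0_def)
    also have "\<dots> \<le> c * spectral_norm A ^ k" by (rule deriv_le)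
    also have "\<dots> \<le> c * S ^ k"
    proof (rule mult_left_mono)
      have "spectral_norm A ^ k \<le> \<bar>spectral_norm A\<bar> ^ k" by (metis abs_ge_self power_abs)
      also have "\<dots> \<le> S ^ k" by (intro power_mono) (auto simp: S_def)
      finally show "spectral_norm A ^ k \<le> S ^ k" .
    qed (use c in simp)
    finally show ?thesis .
  qed
  define D where "D = (\<Sum>i<n. cmod (u0 $ i)) + c"
  define R where "R = (\<Sum>i<n. \<Sum>j<n. cmod (A $$ (i, j))) + 4 * S"
  have D: "D \<ge> 0" unfolding D_def using c by (intro add_nonneg_nonneg sum_nonneg) auto
  have "(\<Sum>i<n. \<Sum>j<n. cmod (A $$ (i, j))) \<ge> 0" by (intro sum_nonneg) auto
  then have R: "R \<ge> 1" using S by (simp add: R_def)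
  define x where "x = (\<lambda>N k i. top_krylov kind A u0 w N k $ i)"
  have x_le: "cmod (x N k i) \<le> D * R ^ k" if "i < n" for N k i
    unfolding x_def D_def R_def using top_krylov_bound[OF A u0 _ S small that, of N k] c by simp
  \<comment> \<open>\<open>krylov_bound\<close> yields \<open>D R\<^sup>N (1 + \<bar>C\<bar>)\<^sup>N\<^sup>+\<^sup>k\<close>; for \<open>k \<ge> N\<close> the exponents \<open>N\<close> and \<open>N + k\<close> are
      at most \<open>k\<close> and \<open>2 k\<close>.\<close>
  define K where "K = R * (1 + \<bar>C\<bar>) ^ 2"
  have K: "K \<ge> R" unfolding K_def using R mult_left_mono[OF one_le_power[of "1 + \<bar>C\<bar>" 2], of R] by simp
  define z where "z = (\<lambda>N k i. arnoldi_beta u0 N * (arnoldi_Q1 kind A u0 w N *\<^sub>v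
      ((arnoldi_F kind A u0 w N ^\<^sub>m k) *\<^sub>v unit_vec N 0)) $ i)"
  have zx: "z N k i = x N k i" if "k < N" "i < n" for N k i
    unfolding z_def x_def by (rule arnoldi_matches_krylov[OF A u0 that])
  have z_le: "cmod (z N k i) \<le> D * K ^ k" if N: "N > 0" "N \<le> k" and i: "i < n" for N k i
  proof -
    let ?F = "arnoldi_F kind A u0 w N" and ?\<beta> = "arnoldi_beta u0 N"
    \<comment> \<open>With \<open>\<beta>\<close> absorbed into \<open>L\<close>, the bound on the first \<open>N\<close> terms covers it.\<close>
    define L where "L = ?\<beta> \<cdot>\<^sub>m arnoldi_Q1 kind A u0 w N"
    have F: "?F \<in> carrier_mat N N" by (rule arnoldi_F_carrier[OF A])
    have Q1: "arnoldi_Q1 kind A u0 w N \<in> carrier_mat n N" using A by (simp add: arnoldi_Q1_def)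
    then have L: "L \<in> carrier_mat n N" by (simp add: L_def)
    have Lz: "(L *\<^sub>v ((?F ^\<^sub>m k) *\<^sub>v unit_vec N 0)) $ i = z N k i" for k
    proof -
      have v: "(?F ^\<^sub>m k) *\<^sub>v unit_vec N 0 \<in> carrier_vec N"
        by (rule mult_mat_vec_carrier[OF pow_carrier_mat[OF F] unit_vec_carrier])
      show ?thesis
        unfolding z_def mult_mat_vec_index_sum[OF L v i] mult_mat_vec_index_sum[OF Q1 v i] sum_distrib_left
        using carrier_matD[OF Q1] i by (intro sum.cong refl) (simp add: L_def mult.assoc del: index_mult_mat_vec)
    qed
    have "cmod (z N k i) \<le> D * R ^ N * (1 + \<bar>C\<bar>) ^ (N + k)"
      unfolding Lz[symmetric]
    proof (rule krylov_bound[OF F L unit_vec_carrier i])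
      show "cmod e \<le> \<bar>C\<bar>" if "eigenvalue ?F e" for e
        by (rule eigenvalue_le_of_power_norm[OF F that N(1) F_le[OF N(1)]])
      fix k assume k: "k < N"
      have "cmod (x N k i) \<le> D * R ^ k" by (rule x_le[OF i])
      also have "\<dots> \<le> D * R ^ N" using D R k by (intro mult_left_mono power_increasing) auto
      finally show "cmod ((L *\<^sub>v ((?F ^\<^sub>m k) *\<^sub>v unit_vec N 0)) $ i) \<le> D * R ^ N"
        unfolding Lz zx[OF k i] .
    qed (use D R in auto)
    also have "\<dots> \<le> D * R ^ k * (1 + \<bar>C\<bar>) ^ (2 * k)"
      using D R N by (intro mult_mono mult_left_mono power_increasing) auto
    also have "\<dots> = D * K ^ k" by (simp add: K_def power_mult_distrib mult_ac flip: power_mult)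
    finally show ?thesis .
  qed
  \<comment> \<open>\<open>G\<close> is the common majorant of both exponential series and \<open>T N\<close> is its tail from index \<open>N\<close> on.\<close>
  define G where "G = (\<lambda>k. D * (t * K) ^ k / fact k)"
  have G: "summable G"
    unfolding G_def using summable_mult[OF summable_exp[of "t * K"], of D] by (simp add: field_simps)
  define T where "T = (\<lambda>N. suminf G - (\<Sum>k<N. G k))"
  have T0: "T \<longlonglongrightarrow> 0"
    unfolding T_def using tendsto_diff[OF tendsto_const[of "suminf G"] summable_LIMSEQ[OF G]] by simp
  have term_le: "cmod (1 / fact k * complex_of_real t ^ k * y) \<le> G k" if "cmod y \<le> D * K ^ k" for y k
  proof -
    have "t ^ k / fact k * cmod y \<le> t ^ k / fact k * (D * K ^ k)"
      using t that by (intro mult_left_mono) auto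
    then show ?thesis
      using t by (simp add: norm_mult norm_divide norm_power G_def power_mult_distrib mult_ac)
  qed
  have x_sums: "(\<lambda>k. 1 / fact k * complex_of_real t ^ k * x N k i) sums truncated_sol kind A u0 w N t $ i"
    if i: "i < n" for N i
  proof -
    have H: "cbasis_mat kind N \<in> carrier_mat N N" by auto
    have top: "(top_selector n N *\<^sub>v ((augmented_mat kind A w N ^\<^sub>m k) *\<^sub>v start_vec u0 N)) $ i = x N k i" for k
      unfolding augmented_mat_krylov[OF A u0] x_def
      by (rule top_selector_index[OF top_krylov_carrier[OF A u0] mult_mat_vec_carrier[OF pow_carrier_mat[OF H] unit_vec_carrier] i])
    let ?b = "start_vec u0 N" and ?M = "augmented_mat kind A w N"
    have "(\<lambda>k. 1 / fact k * complex_of_real t ^ k * (top_selector n N *\<^sub>v ((?M ^\<^sub>m k) *\<^sub>v ?b)) $ i)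
        sums (top_selector n N *\<^sub>v (mat_power_series (\<lambda>k. 1 / fact k) (complex_of_real t \<cdot>\<^sub>m ?M) *\<^sub>v ?b)) $ i"
      by (rule mat_power_series_sums[OF augmented_mat_carrier[OF A] top_selector_carrier start_vec_carrier[OF u0] i])
        (simp add: norm_divide)
    then show ?thesis
      unfolding top truncated_sol_def mat_exp_def carrier_matD(1)[OF A] .
  qed
  have z_sums: "(\<lambda>k. a k * complex_of_real t ^ k * z N k i) sums
      (arnoldi_beta u0 N \<cdot>\<^sub>v (arnoldi_Q1 kind A u0 w N *\<^sub>v
         (mat_power_series a (complex_of_real t \<cdot>\<^sub>m arnoldi_F kind A u0 w N) *\<^sub>v unit_vec N 0))) $ i"
    if i: "i < n" and a: "\<And>k. cmod (a k) \<le> 1 / fact k" for N i a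
  proof -
    have Q1: "arnoldi_Q1 kind A u0 w N \<in> carrier_mat n N" using A by (simp add: arnoldi_Q1_def)
    let ?F = "arnoldi_F kind A u0 w N" and ?Q1 = "arnoldi_Q1 kind A u0 w N"
    have "(\<lambda>k. a k * complex_of_real t ^ k * (?Q1 *\<^sub>v ((?F ^\<^sub>m k) *\<^sub>v unit_vec N 0)) $ i)
        sums (?Q1 *\<^sub>v (mat_power_series a (complex_of_real t \<cdot>\<^sub>m ?F) *\<^sub>v unit_vec N 0)) $ i"
      by (rule mat_power_series_sums[OF arnoldi_F_carrier[OF A] Q1 unit_vec_carrier i a])
    from sums_mult[OF this, of "arnoldi_beta u0 N"] show ?thesis
      using carrier_matD[OF Q1] i unfolding z_def by (simp add: mult_ac del: index_mult_mat_vec(1))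
  qed
  have tail: "cmod (arnoldi_tail kind A u0 w N t $ i) \<le> T N" if N: "N > 0" and i: "i < n" for N i
  proof -
    let ?a = "\<lambda>k. if k < N then 0 else 1 / fact k :: complex"
    let ?v = "arnoldi_beta u0 N \<cdot>\<^sub>v (arnoldi_Q1 kind A u0 w N *\<^sub>v
         (mat_exp_tail N (complex_of_real t \<cdot>\<^sub>m arnoldi_F kind A u0 w N) *\<^sub>v unit_vec N 0))"
    have "(\<lambda>k. ?a k * complex_of_real t ^ k * z N k i) sums ?v $ i"
      unfolding mat_exp_tail_def by (rule z_sums[OF i]) (simp add: norm_divide)
    then have "cmod (?v $ i) \<le> T N"
      unfolding T_def using z_le[OF N _ i] term_le G by (elim sums_tail_bound) auto
    then show ?thesis
      using A i unfolding arnoldi_tail_def by (simp add: arnoldi_Q1_def del: index_mult_mat_vec(1))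
  qed
  have error: "cmod ((truncated_sol kind A u0 w N t - arnoldi_sol kind A u0 w N t) $ i) \<le> 2 * T N"
    if N: "N > 0" and i: "i < n" for N i
  proof -
    have dims: "dim_vec (arnoldi_sol kind A u0 w N t) = n"
      using A by (simp add: arnoldi_sol_def arnoldi_Q1_def)
    have "(\<lambda>k. 1 / fact k * complex_of_real t ^ k * z N k i) sums arnoldi_sol kind A u0 w N t $ i"
      unfolding arnoldi_sol_def mat_exp_def by (rule z_sums[OF i]) (simp add: norm_divide)
    from sums_diff[OF x_sums[OF i] this]
    have d: "(\<lambda>k. 1 / fact k * complex_of_real t ^ k * (x N k i - z N k i)) sums
        (truncated_sol kind A u0 w N t - arnoldi_sol kind A u0 w N t) $ i"
      using dims i by (simp add: right_diff_distrib)
    have "cmod ((truncated_sol kind A u0 w N t - arnoldi_sol kind A u0 w N t) $ i)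
        \<le> suminf (\<lambda>k. 2 * G k) - (\<Sum>k<N. 2 * G k)"
    proof (rule sums_tail_bound[OF d])
      fix k
      show "1 / fact k * complex_of_real t ^ k * (x N k i - z N k i) = 0" if "k < N"
        using zx[OF that i] by simp
      assume k: "N \<le> k"
      have "D * R ^ k \<le> D * K ^ k" using D R K by (intro mult_left_mono power_mono) auto
      then have "cmod (x N k i) \<le> D * K ^ k" using x_le[OF i, of N k] by linarith
      from term_le[OF this] term_le[OF z_le[OF N k i]]
      show "cmod (1 / fact k * complex_of_real t ^ k * (x N k i - z N k i)) \<le> 2 * G k"
        using norm_triangle_ineq4[of "1 / fact k * complex_of_real t ^ k * x N k i" "1 / fact k * complex_of_real t ^ k * z N k i"]
        unfolding right_diff_distrib by linarith
    qed (use G in \<open>simp add: summable_mult\<close>)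
    also have "\<dots> = 2 * T N" using suminf_mult[OF G, of 2] by (simp add: T_def sum_distrib_left)
    finally show ?thesis .
  qed
  have null: "(\<lambda>N. l2_norm (v N)) \<longlonglongrightarrow> 0"
    if "\<And>N. v N \<in> carrier_vec n" and "\<And>N i. N > 0 \<Longrightarrow> i < n \<Longrightarrow> cmod (v N $ i) \<le> 2 * T N"
    for v :: "nat \<Rightarrow> complex vec"
  proof (rule Lim_null_comparison)
    show "\<forall>\<^sub>F N in sequentially. norm (l2_norm (v N)) \<le> real n * (2 * T N)"
      by (rule eventually_mono[OF eventually_gt_at_top[of 0]])
        (use that l2_norm_nonneg in \<open>auto intro!: l2_norm_le_uniform\<close>)
    show "(\<lambda>N. real n * (2 * T N)) \<longlonglongrightarrow> 0"
      using tendsto_mult_left[OF T0, of "real n * 2"] by (simp add: mult.assoc)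
  qed
  show ?thesis
  proof
    show "(\<lambda>N. l2_norm (arnoldi_tail kind A u0 w N t)) \<longlonglongrightarrow> 0"
    proof (rule null)
      show "arnoldi_tail kind A u0 w N t \<in> carrier_vec n" for N
        using A by (intro carrier_vecI) (simp add: arnoldi_tail_def arnoldi_Q1_def)
      show "cmod (arnoldi_tail kind A u0 w N t $ i) \<le> 2 * T N" if "N > 0" "i < n" for N i
        using tail[OF that] norm_ge_zero[of "arnoldi_tail kind A u0 w N t $ i"] by linarith
    qed
    show "(\<lambda>N. l2_norm (truncated_sol kind A u0 w N t - arnoldi_sol kind A u0 w N t)) \<longlonglongrightarrow> 0"
    proof (rule null)
      show "truncated_sol kind A u0 w N t - arnoldi_sol kind A u0 w N t \<in> carrier_vec n" for N
        using A by (intro carrier_vecI) (simp add: arnoldi_sol_def arnoldi_Q1_def)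
      show "cmod ((truncated_sol kind A u0 w N t - arnoldi_sol kind A u0 w N t) $ i) \<le> 2 * T N"
        if "N > 0" "i < n" for N i by (rule error[OF that])
    qed
  qed
qed

end
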